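(* Let $p$ be a constant with $0<p\le \frac12$ and put $q=1-p$. Let $G\in\mathcal{G}(n,p)$. Then with probability tending to $1$ as $n\to\infty$, $$-O(1)\;\le\; D(G)-\log_{1/p} n+2\log_{1/p}\ln n\;\le\;(2+o(1))\,\frac{\ln\ln n}{-p\ln p-q\ln q},$$ where the $O(1)$ is bounded by a constant (depending only on $p$) and the $o(1)$ is a deterministic function tending to $0$ as $n\to\infty$.
   Context: Graphs are finite and simple. First order sentences about graphs are built from variables (ranging over vertices), the relations $=$ and $\sim$ (adjacency), the quantifiers $\forall,\exists$ and the Boolean connectives; infinite sentences are not allowed. The quantifier depth of a sentence is the maximum number of nested quantifiers in it. A sentence $A$ defines a graph $G$ if $G\models A$ and $H\not\models A$ for every graph $H$ not isomorphic to $G$. $D(G)$ denotes the minimum quantifier depth of a first order sentence defining $G$. $\mathcal{G}(n,p)$ is the Erdős–Rényi random graph on vertex set $\{1,\dots,n\}$ in which each pair is an edge independently with probability $p$. *)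

theory Defs
  imports "HOL-Probability.Probability"
begin

section \<open>Finite simple graphs\<close>

text \<open>
  Vertices are natural numbers. This loses nothing: every finite graph is isomorphic to one
  of this kind, and truth of first order sentences is invariant under isomorphism.
\<close>

record ugraph =
  verts :: "nat set"
  edges :: "nat set set"

definition vpairs :: "nat set \<Rightarrow> nat set set" where
  "vpairs V = {e. e \<subseteq> V \<and> card e = 2}"

definition simple_graph :: "ugraph \<Rightarrow> bool" where
  "simple_graph G \<longleftrightarrow> finite (verts G) \<and> edges G \<subseteq> vpairs (verts G)"

definition adjacent :: "ugraph \<Rightarrow> nat \<Rightarrow> nat \<Rightarrow> bool" where
  "adjacent G u v \<longleftrightarrow> {u, v} \<in> edges G"

definition graph_iso :: "ugraph \<Rightarrow> ugraph \<Rightarrow> bool" where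
  "graph_iso G H \<longleftrightarrow> (\<exists>f. bij_betw f (verts G) (verts H) \<and>
     (\<forall>u\<in>verts G. \<forall>v\<in>verts G. adjacent G u v \<longleftrightarrow> adjacent H (f u) (f v)))"

section \<open>First order logic of graphs\<close>

datatype fm =
    Eq nat nat
  | Adj nat nat
  | Neg fm
  | Conj fm fm
  | Disj fm fm
  | Impl fm fm
  | Ex nat fm
  | All nat fm

primrec sat :: "ugraph \<Rightarrow> (nat \<Rightarrow> nat) \<Rightarrow> fm \<Rightarrow> bool" where
  "sat G s (Eq x y) \<longleftrightarrow> s x = s y"
| "sat G s (Adj x y) \<longleftrightarrow> adjacent G (s x) (s y)"
| "sat G s (Neg A) \<longleftrightarrow> \<not> sat G s A"
| "sat G s (Conj A B) \<longleftrightarrow> sat G s A \<and> sat G s B"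
| "sat G s (Disj A B) \<longleftrightarrow> sat G s A \<or> sat G s B"
| "sat G s (Impl A B) \<longleftrightarrow> (sat G s A \<longrightarrow> sat G s B)"
| "sat G s (Ex x A) \<longleftrightarrow> (\<exists>v\<in>verts G. sat G (s(x := v)) A)"
| "sat G s (All x A) \<longleftrightarrow> (\<forall>v\<in>verts G. sat G (s(x := v)) A)"

primrec free_vars :: "fm \<Rightarrow> nat set" where
  "free_vars (Eq x y) = {x, y}"
| "free_vars (Adj x y) = {x, y}"
| "free_vars (Neg A) = free_vars A"
| "free_vars (Conj A B) = free_vars A \<union> free_vars B"
| "free_vars (Disj A B) = free_vars A \<union> free_vars B"
| "free_vars (Impl A B) = free_vars A \<union> free_vars B"
| "free_vars (Ex x A) = free_vars A - {x}"
| "free_vars (All x A) = free_vars A - {x}"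

definition sentence :: "fm \<Rightarrow> bool" where
  "sentence A \<longleftrightarrow> free_vars A = {}"

primrec qdepth :: "fm \<Rightarrow> nat" where
  "qdepth (Eq x y) = 0"
| "qdepth (Adj x y) = 0"
| "qdepth (Neg A) = qdepth A"
| "qdepth (Conj A B) = max (qdepth A) (qdepth B)"
| "qdepth (Disj A B) = max (qdepth A) (qdepth B)"
| "qdepth (Impl A B) = max (qdepth A) (qdepth B)"
| "qdepth (Ex x A) = Suc (qdepth A)"
| "qdepth (All x A) = Suc (qdepth A)"

text \<open>
  Only applied to sentences, whose truth value does not depend on the assignment. The assignment
  is not required to take values in the vertex set, so that the condition is not vacuous
  for the graph without vertices.
\<close>

definition models :: "ugraph \<Rightarrow> fm \<Rightarrow> bool" where
  "models G A \<longleftrightarrow> (\<forall>s. sat G s A)"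

definition defines_graph :: "fm \<Rightarrow> ugraph \<Rightarrow> bool" where
  "defines_graph A G \<longleftrightarrow> sentence A \<and> models G A \<and>
     (\<forall>H. simple_graph H \<and> \<not> graph_iso G H \<longrightarrow> \<not> models H A)"

text \<open>
  The least element exists for every finite simple graph, since each of them is defined by
  some sentence.
\<close>

definition logical_depth :: "ugraph \<Rightarrow> nat" where
  "logical_depth G = (LEAST k. \<exists>A. defines_graph A G \<and> qdepth A = k)"

section \<open>The Erdos-Renyi random graph\<close>

definition random_graph :: "nat \<Rightarrow> real \<Rightarrow> ugraph pmf" where
  "random_graph n p =
     map_pmf (\<lambda>X. \<lparr>verts = {1..n}, edges = {e \<in> vpairs {1..n}. X e}\<rparr>)
       (Pi_pmf (vpairs {1..n}) False (\<lambda>_. bernoulli_pmf p))"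

end

theory Submission
  imports Defs "HOL-Real_Asymp.Real_Asymp"
begin

text \<open>
  Upper bound: let \<open>W\<close> consist of about \<open>log\<^bsub>1/p\<^esub> n\<close> vertices and let \<open>S\<close> be the set of vertices
  that are determined by their adjacencies to \<open>W\<close>. If no two of the remaining vertices have the same
  adjacencies to \<open>S\<close>, then the graph is definable in quantifier depth \<open>\<bar>W\<bar> + 3\<close>: Spoiler selects
  \<open>W\<close> in the Ehrenfeucht game and exhibits any difference in three further moves. In the random
  graph, \<open>n p\<^bsup>\<bar>W\<bar>\<^esup>\<close> is of constant order, so each of the \<open>\<bar>W\<bar> choose 2\<close> adjacency patterns that omit exactly
  two vertices of \<open>W\<close> is taken by exactly one vertex with probability bounded away from 0; by the
  second moment method \<open>S\<close> has order at least \<open>ln\<^sup>2 n\<close>, and a union bound over pairs shows that \<open>S\<close>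
  separates the rest. This gives \<open>D(G) \<le> log\<^bsub>1/p\<^esub> n + 4\<close>, which suffices because the entropy
  \<open>- p ln p - q ln q\<close> is at most \<open>ln (1/p)\<close>.

  Lower bound: for \<open>l = log\<^bsub>1/p\<^esub> n - 2 log\<^bsub>1/p\<^esub> ln n - O(1)\<close>, with high probability every adjacency
  pattern to every set of at most \<open>l\<close> vertices is realised, both with \<open>n\<close> and with \<open>n + 1\<close> vertices. Hence
  \<open>G\<close> agrees up to quantifier depth \<open>l + 1\<close> with some graph on \<open>n + 1\<close> vertices.
\<close>

section \<open>Ehrenfeucht games and sifting sets\<close>

definition partial_iso :: "ugraph \<Rightarrow> ugraph \<Rightarrow> (nat \<times> nat) set \<Rightarrow> bool" where
  "partial_iso G H R \<longleftrightarrow> (\<forall>a b c d. (a, b) \<in> R \<longrightarrow> (c, d) \<in> R \<longrightarrow>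
     (a = c \<longleftrightarrow> b = d) \<and> (adjacent G a c \<longleftrightarrow> adjacent H b d))"

text \<open>Duplicator wins the Ehrenfeucht game with \<open>k\<close> moves from the position
  \<open>R\<close>. A position is a set of pairs, so the order of moves is forgotten. It is tested
  only after the last move: partial isomorphisms pass to subsets, so an earlier violation would
  persist.\<close>

primrec ef_equiv :: "nat \<Rightarrow> ugraph \<Rightarrow> ugraph \<Rightarrow> (nat \<times> nat) set \<Rightarrow> bool" where
  "ef_equiv 0 G H R \<longleftrightarrow> partial_iso G H R"
| "ef_equiv (Suc k) G H R \<longleftrightarrow>
     (\<forall>v\<in>verts G. \<exists>w\<in>verts H. ef_equiv k G H (insert (v, w) R)) \<and>
     (\<forall>w\<in>verts H. \<exists>v\<in>verts G. ef_equiv k G H (insert (v, w) R))"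

lemma partial_isoD:
  assumes "partial_iso G H R" "(a, b) \<in> R" "(c, d) \<in> R"
  shows "a = c \<longleftrightarrow> b = d" "adjacent G a c \<longleftrightarrow> adjacent H b d"
  using assms unfolding partial_iso_def by blast+

lemma ef_equiv_mono: "ef_equiv k G H R \<Longrightarrow> R' \<subseteq> R \<Longrightarrow> ef_equiv k G H R'"
proof (induction k arbitrary: R R')
  case 0
  then show ?case unfolding ef_equiv.simps partial_iso_def by blast
next
  case (Suc k)
  have sub: "insert x R' \<subseteq> insert x R" for x using Suc.prems by auto
  show ?case using Suc.prems(1) Suc.IH[OF _ sub] unfolding ef_equiv.simps by meson
qed

lemma ef_equiv_Suc_imp:
  assumes "ef_equiv (Suc k) G H R" "verts G \<noteq> {}"
  shows "ef_equiv k G H R"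
proof -
  obtain v where "v \<in> verts G" using assms by auto
  then obtain w where "ef_equiv k G H (insert (v, w) R)" using assms by auto
  then show ?thesis by (rule ef_equiv_mono) auto
qed

lemma ef_equiv_refl: "R \<subseteq> Id \<Longrightarrow> ef_equiv k G G R"
proof (induction k arbitrary: R)
  case 0
  then show ?case unfolding ef_equiv.simps partial_iso_def by auto
next
  case (Suc k)
  have "ef_equiv k G G (insert (v, v) R)" for v using Suc by simp
  then show ?case unfolding ef_equiv.simps by blast
qed

text \<open>Spoiler plays the vertices of \<open>xs\<close> in turn; \<open>ys\<close> collects the
  answers, and \<open>k\<close> moves are left.\<close>

lemma ef_equiv_play:
  assumes "ef_equiv (length xs + k) G H R" "set xs \<subseteq> verts G"
  shows "\<exists>ys. length ys = length xs \<and> ef_equiv k G H (R \<union> set (zip xs ys))"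
  using assms
proof (induction xs arbitrary: R)
  case Nil
  then show ?case by simp
next
  case (Cons x xs)
  then obtain y where "ef_equiv (length xs + k) G H (insert (x, y) R)" by auto
  then obtain ys where "length ys = length xs"
      "ef_equiv k G H (insert (x, y) R \<union> set (zip xs ys))"
    using Cons.IH[of "insert (x, y) R"] Cons.prems by auto
  then show ?case by (intro exI[of _ "y # ys"]) auto
qed

section \<open>Hintikka formulas\<close>

definition signed :: "bool \<Rightarrow> fm \<Rightarrow> fm" where
  "signed b A = (if b then A else Neg A)"

text \<open>Variable \<open>i\<close> stands for the vertex \<open>vs ! i\<close>. The formula
  \<open>Eq 0 0\<close> that closes the fold is true but mentions variable 0, so the diagram of the
  empty list is not a sentence.\<close>

definition diagram :: "ugraph \<Rightarrow> nat list \<Rightarrow> fm" where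
  "diagram G vs = foldr Conj
     [Conj (signed (vs ! i = vs ! j) (Eq i j)) (signed (adjacent G (vs ! i) (vs ! j)) (Adj i j)).
       i \<leftarrow> [0..<length vs], j \<leftarrow> [0..<length vs]] (Eq 0 0)"

text \<open>The new variable \<open>length vs\<close> is the first index not yet in use. The true
  and false formulas that close the folds have \<open>x\<close> bound, by their own or by the
  surrounding quantifier, so they add no free variable.\<close>

primrec hintikka :: "nat \<Rightarrow> ugraph \<Rightarrow> nat list \<Rightarrow> fm" where
  "hintikka 0 G vs = diagram G vs"
| "hintikka (Suc k) G vs = (let x = length vs; As = map (\<lambda>v. hintikka k G (vs @ [v])) (sorted_list_of_set (verts G)) in
     Conj (foldr Conj (map (Ex x) As) (All x (Eq x x))) (All x (foldr Disj As (Neg (Eq x x)))))"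

lemma sat_foldr_Conj: "sat H t (foldr Conj As B) \<longleftrightarrow> (\<forall>A\<in>set As. sat H t A) \<and> sat H t B"
  by (induction As) auto

lemma sat_foldr_Disj: "sat H t (foldr Disj As B) \<longleftrightarrow> (\<exists>A\<in>set As. sat H t A) \<or> sat H t B"
  by (induction As) auto

lemma sat_signed: "sat H t (signed b A) \<longleftrightarrow> (sat H t A \<longleftrightarrow> b)"
  by (simp add: signed_def)

lemma qdepth_foldr_Conj:
  "(\<And>A. A \<in> set As \<Longrightarrow> qdepth A \<le> k) \<Longrightarrow> qdepth B \<le> k \<Longrightarrow> qdepth (foldr Conj As B) \<le> k"
  by (induction As) auto

lemma qdepth_foldr_Disj:
  "(\<And>A. A \<in> set As \<Longrightarrow> qdepth A \<le> k) \<Longrightarrow> qdepth B \<le> k \<Longrightarrow> qdepth (foldr Disj As B) \<le> k"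
  by (induction As) auto

lemma free_vars_foldr_Conj: "free_vars (foldr Conj As B) = (\<Union>A\<in>set As. free_vars A) \<union> free_vars B"
  by (induction As) auto

lemma free_vars_foldr_Disj: "free_vars (foldr Disj As B) = (\<Union>A\<in>set As. free_vars A) \<union> free_vars B"
  by (induction As) auto

lemma qdepth_diagram: "qdepth (diagram G vs) = 0"
  unfolding diagram_def
  by (rule le_zero_eq[THEN iffD1], rule qdepth_foldr_Conj) (auto simp: signed_def)

lemma free_vars_diagram: "vs \<noteq> [] \<Longrightarrow> free_vars (diagram G vs) \<subseteq> {..<length vs}"
  unfolding diagram_def by (auto simp: free_vars_foldr_Conj signed_def split: if_splits)

lemma sat_diagram:
  "sat H t (diagram G vs) \<longleftrightarrow> partial_iso G H (set (zip vs (map t [0..<length vs])))"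
proof -
  let ?n = "length vs"
  have "sat H t (diagram G vs) \<longleftrightarrow> (\<forall>i<?n. \<forall>j<?n.
      (t i = t j \<longleftrightarrow> vs ! i = vs ! j) \<and> (adjacent H (t i) (t j) \<longleftrightarrow> adjacent G (vs ! i) (vs ! j)))"
    unfolding diagram_def sat_foldr_Conj by (simp add: sat_signed) (simp add: Ball_def)
  moreover have "(a, b) \<in> set (zip vs (map t [0..<?n])) \<longleftrightarrow> (\<exists>i<?n. a = vs ! i \<and> b = t i)" for a b
    by (auto simp: in_set_zip)
  ultimately show ?thesis unfolding partial_iso_def by (simp only:) blast
qed

lemma qdepth_hintikka: "qdepth (hintikka k G vs) \<le> k"
proof (induction k arbitrary: vs)
  case 0
  then show ?case by (simp add: qdepth_diagram)
next
  case (Suc k)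
  let ?As = "map (\<lambda>v. hintikka k G (vs @ [v])) (sorted_list_of_set (verts G))"
  have "qdepth (foldr Conj (map (Ex x) ?As) (All x (Eq x x))) \<le> Suc k" for x
    by (rule qdepth_foldr_Conj) (use Suc.IH in auto)
  moreover have "qdepth (foldr Disj ?As (Neg (Eq x x))) \<le> k" for x
    by (rule qdepth_foldr_Disj) (use Suc.IH in auto)
  ultimately show ?case by (simp add: Let_def)
qed

lemma free_vars_hintikka:
  "vs \<noteq> [] \<or> k > 0 \<Longrightarrow> free_vars (hintikka k G vs) \<subseteq> {..<length vs}"
proof (induction k arbitrary: vs)
  case 0
  then show ?case using free_vars_diagram by simp
next
  case (Suc k)
  have "free_vars (hintikka k G (vs @ [v])) \<subseteq> {..length vs}" for v
    using Suc.IH[of "vs @ [v]"] by (simp add: lessThan_Suc_atMost)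
  then show ?case
    by (fastforce simp: Let_def free_vars_foldr_Conj free_vars_foldr_Disj)
qed

text \<open>The half of the Ehrenfeucht-Fraisse theorem that produces formulas: the conjunction
  answers Spoiler's moves in \<open>G\<close>, the disjunction under \<open>All\<close> those in
  \<open>H\<close>. Finiteness lets both range over all vertices of \<open>G\<close>.\<close>

lemma sat_hintikka:
  assumes "finite (verts G)"
  shows "sat H t (hintikka k G vs) \<longleftrightarrow> ef_equiv k G H (set (zip vs (map t [0..<length vs])))"
proof (induction k arbitrary: t vs)
  case 0
  then show ?case by (simp add: sat_diagram)
next
  case (Suc k)
  let ?R = "set (zip vs (map t [0..<length vs]))"
  have step: "sat H (t(length vs := w)) (hintikka k G (vs @ [v])) \<longleftrightarrow> ef_equiv k G H (insert (v, w) ?R)" for v w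
  proof -
    have "map (t(length vs := w)) [0..<length vs] = map t [0..<length vs]" by simp
    then have "set (zip (vs @ [v]) (map (t(length vs := w)) [0..<length (vs @ [v])])) = insert (v, w) ?R"
      by simp
    then show ?thesis unfolding Suc.IH by (simp only:)
  qed
  have "sat H t (hintikka (Suc k) G vs) \<longleftrightarrow>
      (\<forall>v\<in>verts G. \<exists>w\<in>verts H. sat H (t(length vs := w)) (hintikka k G (vs @ [v]))) \<and>
      (\<forall>w\<in>verts H. \<exists>v\<in>verts G. sat H (t(length vs := w)) (hintikka k G (vs @ [v])))"
    using assms by (simp add: Let_def sat_foldr_Conj sat_foldr_Disj del: fun_upd_apply)
  then show ?case unfolding step by simp
qed

text \<open>The Hintikka formula holds exactly in the graphs against which Duplicator wins, so it
  defines \<open>G\<close> once a win forces isomorphism. For \<open>k = 0\<close> it would have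
  variable 0 free.\<close>

lemma defines_hintikka:
  assumes "simple_graph G" "k > 0"
    and "\<And>H. simple_graph H \<Longrightarrow> ef_equiv k G H {} \<Longrightarrow> graph_iso G H"
  shows "defines_graph (hintikka k G []) G"
proof -
  have "finite (verts G)" using assms by (simp add: simple_graph_def)
  then have sat: "sat H t (hintikka k G []) \<longleftrightarrow> ef_equiv k G H {}" for H t
    using sat_hintikka[of G H t k "[]"] by simp
  have "ef_equiv k G G {}" by (rule ef_equiv_refl) simp
  moreover have "free_vars (hintikka k G []) = {}"
    using free_vars_hintikka[of "[]" k G] assms(2) by simp
  ultimately show ?thesis
    unfolding defines_graph_def sentence_def models_def sat using assms(3) by blast
qed

section \<open>Sifting sets and the upper bound on the depth\<close>

definition sifted :: "ugraph \<Rightarrow> nat set \<Rightarrow> nat set" where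
  "sifted G W = {v \<in> verts G - W. \<forall>u\<in>verts G - W.
     (\<forall>w\<in>W. adjacent G u w \<longleftrightarrow> adjacent G v w) \<longrightarrow> u = v}"

definition weakly_sifting :: "ugraph \<Rightarrow> nat set \<Rightarrow> bool" where
  "weakly_sifting G W \<longleftrightarrow> sifted G (W \<union> sifted G W) = verts G - (W \<union> sifted G W)"

text \<open>Agreement on \<open>W \<union> sifted G W\<close> includes agreement on
  \<open>sifted G W\<close>, so it suffices that the sifted vertices alone separate the rest. In the
  random graph the edges concerned are independent of those that decide which vertices are
  sifted.\<close>

lemma weakly_siftingI:
  assumes "\<And>u v. u \<in> verts G - W - sifted G W \<Longrightarrow> v \<in> verts G - W - sifted G W \<Longrightarrow>
    (\<forall>w\<in>sifted G W. adjacent G u w \<longleftrightarrow> adjacent G v w) \<Longrightarrow> u = v"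
  shows "weakly_sifting G W"
  unfolding weakly_sifting_def sifted_def[of G "W \<union> sifted G W"] using assms by blast

text \<open>Spoiler spends \<open>card W\<close> moves on \<open>W\<close>. Of the three moves left,
  the first names an arbitrary vertex; the other two refute a second candidate for its image or a
  wrong adjacency.\<close>

lemma weakly_sifting_determines:
  assumes G: "simple_graph G" and W: "W \<subseteq> verts G" "weakly_sifting G W" and ne: "verts G \<noteq> {}"
    and H: "ef_equiv (card W + 3) G H {}"
  shows "graph_iso G H"
proof -
  have "finite W" using G W(1) finite_subset by (auto simp: simple_graph_def)
  then obtain xs where xs: "set xs = W" "length xs = card W"
    using finite_distinct_list distinct_card by metis
  obtain ys where ys: "length ys = length xs" "ef_equiv 3 G H (set (zip xs ys))"
    using ef_equiv_play[of xs 3 G H "{}"] H W(1) xs by auto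
  define R where "R = set (zip xs ys)"
  \<comment> \<open>After the moves \<open>W\<close>, the relation \<open>E 2\<close> will turn out to be the graph of an isomorphism: \<open>E 0\<close> is
    injective and \<open>E 1\<close> functional on \<open>W \<union> sifted G W\<close>; since this set sifts the rest, \<open>E 1\<close> is
    injective and \<open>E 2\<close> functional everywhere.\<close>
  define E where "E j u v \<longleftrightarrow> u \<in> verts G \<and> v \<in> verts H \<and> ef_equiv j G H (insert (u, v) R)" for j u v
  have dom: "\<exists>b. (a, b) \<in> R" if "a \<in> W" for a
    using that ys(1) xs(1) unfolding R_def by (metis in_set_impl_in_set_zip1)
  have E_Suc: "E j u v" if "E (Suc j) u v" for j u v
    using that ef_equiv_Suc_imp[OF _ ne] unfolding E_def by blast
  have E_drop: "E j u v" if "ef_equiv j G H (insert (u, v) R')" "R \<subseteq> R'" "u \<in> verts G" "v \<in> verts H"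
    for j u v R'
    using ef_equiv_mono[OF that(1)] that(2-4) unfolding E_def by blast
  \<comment> \<open>One more move costs one level of \<open>E\<close>. Its result is used in two
    ways: the new pair over \<open>R\<close>, and the new pair together with the previous
    one.\<close>
  have pick_left: "\<exists>v'\<in>verts H. E j v v' \<and> ef_equiv j G H {(v, v'), (u, u')}"
    if asm: "E (Suc j) u u'" "v \<in> verts G" for j u u' v
  proof -
    obtain v' where v': "v' \<in> verts H" "ef_equiv j G H (insert (v, v') (insert (u, u') R))"
      using \<open>E (Suc j) u u'\<close> \<open>v \<in> verts G\<close> unfolding E_def by auto
    have "ef_equiv j G H {(v, v'), (u, u')}" by (rule ef_equiv_mono[OF v'(2)]) auto
    then show ?thesis using E_drop[OF v'(2)] v'(1) that by blast
  qed
  have pick_right: "\<exists>v\<in>verts G. E j v v' \<and> ef_equiv j G H {(v, v'), (u, u')}"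
    if asm: "E (Suc j) u u'" "v' \<in> verts H" for j u u' v'
  proof -
    obtain v where v: "v \<in> verts G" "ef_equiv j G H (insert (v, v') (insert (u, u') R))"
      using asm unfolding E_def by auto
    have "ef_equiv j G H {(v, v'), (u, u')}" by (rule ef_equiv_mono[OF v(2)]) auto
    then show ?thesis using E_drop[OF v(2)] v(1) that by blast
  qed
  have pair: "(u = v \<longleftrightarrow> u' = v') \<and> (adjacent G u v \<longleftrightarrow> adjacent H u' v')"
    if "ef_equiv j G H {(v, v'), (u, u')}" for j u v u' v'
  proof -
    have "ef_equiv 0 G H {(v, v'), (u, u')}"
      using that by (induction j) (use ef_equiv_Suc_imp[OF _ ne] in blast)+
    then show ?thesis using partial_isoD[of G H "{(v, v'), (u, u')}" u u' v v'] by simp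
  qed
  have total: "\<exists>v. E 2 u v" if "u \<in> verts G" for u
    using ys(2) that unfolding E_def R_def numeral_3_eq_3 numeral_2_eq_2 ef_equiv.simps(2)[of "Suc (Suc 0)"]
    by blast
  have onto: "\<exists>u. E 2 u v" if "v \<in> verts H" for v
    using ys(2) that unfolding E_def R_def numeral_3_eq_3 numeral_2_eq_2 ef_equiv.simps(2)[of "Suc (Suc 0)"]
    by blast
  have E21: "E 1 u v" if "E 2 u v" for u v
    using that E_Suc[of 1 u v] by (simp add: numeral_2_eq_2)
  have E10: "E 0 u v" if "E 1 u v" for u v
    using that E_Suc[of 0 u v] by simp
  define T where "T = W \<union> sifted G W"
  \<comment> \<open>Both \<open>u\<close> and \<open>v\<close> are matched with \<open>u'\<close>
    over the fixed pairs \<open>R\<close>, so they stand in the same relations to every vertex of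
    \<open>W\<close>; a vertex of \<open>W\<close> or a sifted vertex is determined by these
    relations.\<close>
  have inj_T: "u = v" if "u \<in> T" "E 0 u u'" "E 0 v u'" for u v u'
  proof -
    have same: "(u = w \<longleftrightarrow> v = w) \<and> (adjacent G u w \<longleftrightarrow> adjacent G v w)" if "w \<in> W" for w
    proof -
      obtain w' where w': "(w, w') \<in> R" using dom \<open>w \<in> W\<close> by blast
      have *: "partial_iso G H (insert (u, u') R)" "partial_iso G H (insert (v, u') R)"
        using \<open>E 0 u u'\<close> \<open>E 0 v u'\<close> by (auto simp: E_def)
      show ?thesis
        using partial_isoD[OF *(1), of u u' w w'] partial_isoD[OF *(2), of v u' w w'] w' by auto
    qed
    show ?thesis
    proof (cases "u \<in> W")
      case True
      then show ?thesis using same by blast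
    next
      case False
      then have "u \<in> sifted G W" "v \<notin> W" using that same by (auto simp: T_def)
      moreover have "v \<in> verts G" using that by (simp add: E_def)
      ultimately show ?thesis using same unfolding sifted_def by blast
    qed
  qed
  \<comment> \<open>Spoiler plays the second candidate \<open>u''\<close> in \<open>H\<close>. The
    answer \<open>v\<close> shares the image \<open>u''\<close> with \<open>u\<close>, so
    \<open>v = u\<close>, and the two pairs played force \<open>u' = u''\<close>.\<close>
  have fun_T: "u' = u''" if asm: "u \<in> T" "E 1 u u'" "E 0 u u''" for u u' u''
  proof -
    have "u'' \<in> verts H" using that by (simp add: E_def)
    then obtain v where "E 0 v u''" "ef_equiv 0 G H {(v, u''), (u, u')}"
      using pick_right[of 0 u u' u''] asm by auto
    then show ?thesis using inj_T[of u u'' v] that pair by blast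
  qed
  have adj_T: "(u = v \<longleftrightarrow> u' = v') \<and> (adjacent G u v \<longleftrightarrow> adjacent H u' v')"
    if asm: "v \<in> T" "E 1 u u'" "E 1 v v'" for u v u' v'
  proof -
    have "v \<in> verts G" using that by (simp add: E_def)
    then obtain v'' where "E 0 v v''" "ef_equiv 0 G H {(v, v''), (u, u')}"
      using pick_left[of 0 u u' v] asm by auto
    then show ?thesis using fun_T[of v v' v''] that pair by blast
  qed
  have inj: "u = v" if "E 1 u u'" "E 1 v u'" for u v u'
  proof (cases "u \<in> T \<or> v \<in> T")
    case True
    then show ?thesis using inj_T E10 that by metis
  next
    case False
    have "adjacent G u t \<longleftrightarrow> adjacent G v t" if "t \<in> T" for t
    proof -
      have "t \<in> verts G" using \<open>t \<in> T\<close> W(1) by (auto simp: T_def sifted_def)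
      then obtain t' where "E 1 t t'" using total E21 by blast
      then show ?thesis using adj_T \<open>E 1 u u'\<close> \<open>E 1 v u'\<close> \<open>t \<in> T\<close> by blast
    qed
    moreover have "u \<in> verts G" "v \<in> verts G" using that by (auto simp: E_def)
    moreover have "sifted G T = verts G - T"
      using W(2) by (simp add: weakly_sifting_def T_def)
    ultimately show ?thesis using False unfolding sifted_def by blast
  qed
  have fun1: "u' = u''" if asm: "E 2 u u'" "E 1 u u''" for u u' u''
  proof -
    have "u'' \<in> verts H" using that by (simp add: E_def)
    then obtain v where "E 1 v u''" "ef_equiv 1 G H {(v, u''), (u, u')}"
      using pick_right[of 1 u u' u''] asm by (auto simp: numeral_2_eq_2)
    then show ?thesis using inj[of u u'' v] that pair by blast
  qed
  define f where "f u = (SOME v. E 2 u v)" for u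
  have f: "E 2 u (f u)" if "u \<in> verts G" for u
    unfolding f_def using someI_ex[OF total[OF that]] .
  have "bij_betw f (verts G) (verts H)"
  proof (rule bij_betw_imageI)
    show "inj_on f (verts G)" by (rule inj_onI) (metis f E21 inj)
    have "f u \<in> verts H" if "u \<in> verts G" for u using f[OF that] by (simp add: E_def)
    moreover have "v \<in> f ` verts G" if v: "v \<in> verts H" for v
    proof -
      obtain u where u: "E 2 u v" using onto[OF v] by blast
      then have "u \<in> verts G" by (simp add: E_def)
      then show ?thesis using fun1[OF f, of u v] E21[OF u] by blast
    qed
    ultimately show "f ` verts G = verts H" by blast
  qed
  \<comment> \<open>After the pair of \<open>u\<close> and \<open>f u\<close>, Spoiler plays
    \<open>v\<close>; uniqueness of images makes the answer \<open>f v\<close>, so the adjacency is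
    read off from these two pairs.\<close>
  moreover have "adjacent G u v \<longleftrightarrow> adjacent H (f u) (f v)" if "u \<in> verts G" "v \<in> verts G" for u v
  proof -
    obtain v'' where "E 1 v v''" "ef_equiv 1 G H {(v, v''), (u, f u)}"
      using pick_left[of 1 u "f u" v] f[OF \<open>u \<in> verts G\<close>] \<open>v \<in> verts G\<close> by (auto simp: numeral_2_eq_2)
    then show ?thesis using fun1[OF f[OF that(2)], of v''] pair by blast
  qed
  ultimately show ?thesis unfolding graph_iso_def by blast
qed

lemma weakly_sifting_defines:
  assumes "simple_graph G" "W \<subseteq> verts G" "weakly_sifting G W" "verts G \<noteq> {}"
  shows "\<exists>A. defines_graph A G \<and> qdepth A \<le> card W + 3"
  using defines_hintikka[of G "card W + 3"] weakly_sifting_determines[OF assms]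
    qdepth_hintikka[of "card W + 3" G "[]"] assms(1) by auto

section \<open>The extension property\<close>

text \<open>The extension axioms of the zero-one law: \<open>B\<close> prescribes the neighbours and
  \<open>A - B\<close> the non-neighbours of the new vertex.\<close>

definition extension_property :: "nat \<Rightarrow> ugraph \<Rightarrow> bool" where
  "extension_property l G \<longleftrightarrow> (\<forall>A B. B \<subseteq> A \<and> A \<subseteq> verts G \<and> card A \<le> l \<longrightarrow>
     (\<exists>v\<in>verts G - A. \<forall>a\<in>A. adjacent G v a \<longleftrightarrow> a \<in> B))"

lemma adjacent_commute: "adjacent G u v \<longleftrightarrow> adjacent G v u"
  by (simp add: adjacent_def insert_commute)

lemma simple_graph_not_adjacent_self: "simple_graph G \<Longrightarrow> \<not> adjacent G u u"
  by (auto simp: simple_graph_def adjacent_def vpairs_def)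

text \<open>Duplicator answers with a vertex \<open>w\<close> whose adjacencies to the range of
  \<open>R\<close> copy those of \<open>v\<close> to the domain. A vertex already in the domain
  keeps its partner.\<close>

lemma extension_property_extend:
  assumes simple: "simple_graph G" "simple_graph H" and ext: "extension_property l H"
    and R: "finite R" "R \<subseteq> verts G \<times> verts H" "card (snd ` R) \<le> l" "partial_iso G H R"
    and v: "v \<in> verts G"
  shows "\<exists>w\<in>verts H. partial_iso G H (insert (v, w) R)"
proof (cases "\<exists>w. (v, w) \<in> R")
  case True
  then show ?thesis using R by (metis insert_absorb mem_Sigma_iff subsetD)
next
  case False
  define B where "B = {b. \<exists>a. (a, b) \<in> R \<and> adjacent G v a}"
  have "B \<subseteq> snd ` R" "snd ` R \<subseteq> verts H" using R(2) unfolding B_def by force+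
  then obtain w where w: "w \<in> verts H - snd ` R" "\<forall>b\<in>snd ` R. adjacent H w b \<longleftrightarrow> b \<in> B"
    using ext R(3) unfolding extension_property_def by blast
  have "b \<in> B \<longleftrightarrow> adjacent G v a" if "(a, b) \<in> R" for a b
    using that R(4) partial_isoD(1)[OF R(4) that] unfolding B_def by blast
  then have *: "v \<noteq> a \<and> w \<noteq> b \<and> (adjacent H w b \<longleftrightarrow> adjacent G v a) \<and> (adjacent H b w \<longleftrightarrow> adjacent G a v)"
    if "(a, b) \<in> R" for a b
    using that w False adjacent_commute by (metis DiffD2 image_eqI snd_conv)
  have "partial_iso G H (insert (v, w) R)"
    unfolding partial_iso_def
  proof (intro allI impI)
    fix a b c d
    assume "(a, b) \<in> insert (v, w) R" "(c, d) \<in> insert (v, w) R"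
    then show "(a = c \<longleftrightarrow> b = d) \<and> (adjacent G a c \<longleftrightarrow> adjacent H b d)"
      using *[of a b] *[of c d] partial_isoD[OF R(4), of a b c d]
        simple_graph_not_adjacent_self[OF simple(1)] simple_graph_not_adjacent_self[OF simple(2)]
      by auto
  qed
  then show ?thesis using w by blast
qed

lemma partial_iso_converse: "partial_iso H G (R\<inverse>) \<longleftrightarrow> partial_iso G H R"
  unfolding partial_iso_def by blast

lemma extension_property_update:
  assumes simple: "simple_graph G" "simple_graph H" and ext: "extension_property l H"
    and D: "finite D" "x \<notin> D" "card D \<le> l" "s ` D \<subseteq> verts G" "t ` D \<subseteq> verts H"
    and iso: "partial_iso G H ((\<lambda>y. (s y, t y)) ` D)" and v: "v \<in> verts G"
  shows "\<exists>w\<in>verts H. partial_iso G H ((\<lambda>y. ((s(x := v)) y, (t(x := w)) y)) ` insert x D)"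
proof -
  have "card (snd ` (\<lambda>y. (s y, t y)) ` D) \<le> l"
    using card_image_le[OF D(1), of t] D(3) by (simp add: image_image)
  then obtain w where w: "w \<in> verts H" "partial_iso G H (insert (v, w) ((\<lambda>y. (s y, t y)) ` D))"
    using extension_property_extend[OF simple ext _ _ _ iso v] D by auto
  have "(\<lambda>y. ((s(x := v)) y, (t(x := w)) y)) ` insert x D = insert (v, w) ((\<lambda>y. (s y, t y)) ` D)"
    using D(2) by (auto simp: image_iff)
  then show ?thesis using w by (intro bexI[of _ w]) simp_all
qed

text \<open>Induction on the formula, with \<open>D\<close> the set of variables whose values
  matter. Where a quantifier is met, the bound gives \<open>card D \<le> l\<close>, so the extension
  property applies; depth \<open>Suc l\<close> is reached by extending sets of at most
  \<open>l\<close> vertices.\<close>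

lemma extension_property_sat_iff:
  assumes simple: "simple_graph G" "simple_graph H"
    and ext: "extension_property l G" "extension_property l H"
    and "finite D" "free_vars A \<subseteq> D" "s ` D \<subseteq> verts G" "t ` D \<subseteq> verts H"
    and "partial_iso G H ((\<lambda>x. (s x, t x)) ` D)" "card D + qdepth A \<le> Suc l"
  shows "sat G s A \<longleftrightarrow> sat H t A"
proof -
  have quant: "(\<forall>v\<in>verts G. \<exists>w\<in>verts H. sat G (s(x := v)) A \<longleftrightarrow> sat H (t(x := w)) A) \<and>
      (\<forall>w\<in>verts H. \<exists>v\<in>verts G. sat G (s(x := v)) A \<longleftrightarrow> sat H (t(x := w)) A)"
    if IH: "\<And>D s t. \<lbrakk>finite D; free_vars A \<subseteq> D; s ` D \<subseteq> verts G; t ` D \<subseteq> verts H;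
        partial_iso G H ((\<lambda>x. (s x, t x)) ` D); card D + qdepth A \<le> Suc l\<rbrakk> \<Longrightarrow>
        sat G s A \<longleftrightarrow> sat H t A"
      and D: "finite D" "free_vars A - {x} \<subseteq> D" "s ` D \<subseteq> verts G" "t ` D \<subseteq> verts H"
        "partial_iso G H ((\<lambda>x. (s x, t x)) ` D)" "card D + Suc (qdepth A) \<le> Suc l"
    for A D s t x
  proof -
    \<comment> \<open>A variable that is quantified again loses its old value, so \<open>x\<close>
      leaves \<open>D\<close> before the new vertex is chosen.\<close>
    define D' where "D' = D - {x}"
    have D': "finite D'" "x \<notin> D'" "free_vars A \<subseteq> insert x D'" "s ` D' \<subseteq> verts G" "t ` D' \<subseteq> verts H"
      using D unfolding D'_def by auto
    have iso: "partial_iso G H ((\<lambda>x. (s x, t x)) ` D')"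
      using D(5) unfolding D'_def partial_iso_def by blast
    have iso': "partial_iso H G ((\<lambda>x. (t x, s x)) ` D')"
      using iso unfolding partial_iso_def by blast
    have "card D' \<le> card D" unfolding D'_def using D(1) by (simp add: card_mono)
    then have card: "card D' \<le> l" "card (insert x D') + qdepth A \<le> Suc l"
      using D(6) D' by auto
    have upd: "sat G (s(x := v)) A \<longleftrightarrow> sat H (t(x := w)) A"
      if "v \<in> verts G" "w \<in> verts H"
        "partial_iso G H ((\<lambda>y. ((s(x := v)) y, (t(x := w)) y)) ` insert x D')" for v w
    proof (rule IH[OF _ D'(3) _ _ that(3) card(2)])
      show "s(x := v) ` insert x D' \<subseteq> verts G" using D'(4) that(1) by auto
      show "t(x := w) ` insert x D' \<subseteq> verts H" using D'(5) that(2) by auto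
    qed (simp add: D'(1))
    have conv: "partial_iso G H ((\<lambda>y. ((s(x := v)) y, (t(x := w)) y)) ` insert x D')"
      if "partial_iso H G ((\<lambda>y. ((t(x := w)) y, (s(x := v)) y)) ` insert x D')" for v w
    proof -
      have "((\<lambda>y. ((s(x := v)) y, (t(x := w)) y)) ` insert x D')\<inverse> =
          (\<lambda>y. ((t(x := w)) y, (s(x := v)) y)) ` insert x D'"
        by (auto simp del: fun_upd_apply)
      then show ?thesis using that partial_iso_converse by metis
    qed
    show ?thesis
      using upd conv extension_property_update[OF simple ext(2) D'(1,2) card(1) D'(4,5) iso]
        extension_property_update[OF simple(2,1) ext(1) D'(1,2) card(1) D'(5,4) iso']
      by meson
  qed
  show ?thesis
    using assms(5-)
  proof (induction A arbitrary: D s t)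
    case (Eq x y)
    then show ?case using partial_isoD(1)[OF Eq(5), of "s x" "t x" "s y" "t y"] by auto
  next
    case (Adj x y)
    then show ?case using partial_isoD(2)[OF Adj(5), of "s x" "t x" "s y" "t y"] by auto
  next
    case (Neg A)
    then show ?case by simp
  next
    case (Conj A B)
    have "sat G s A \<longleftrightarrow> sat H t A" by (rule Conj.IH(1)) (use Conj.prems in auto)
    moreover have "sat G s B \<longleftrightarrow> sat H t B" by (rule Conj.IH(2)) (use Conj.prems in auto)
    ultimately show ?case by simp
  next
    case (Disj A B)
    have "sat G s A \<longleftrightarrow> sat H t A" by (rule Disj.IH(1)) (use Disj.prems in auto)
    moreover have "sat G s B \<longleftrightarrow> sat H t B" by (rule Disj.IH(2)) (use Disj.prems in auto)
    ultimately show ?case by simp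
  next
    case (Impl A B)
    have "sat G s A \<longleftrightarrow> sat H t A" by (rule Impl.IH(1)) (use Impl.prems in auto)
    moreover have "sat G s B \<longleftrightarrow> sat H t B" by (rule Impl.IH(2)) (use Impl.prems in auto)
    ultimately show ?case by simp
  next
    case (Ex x A)
    have "(\<forall>v\<in>verts G. \<exists>w\<in>verts H. sat G (s(x := v)) A \<longleftrightarrow> sat H (t(x := w)) A) \<and>
        (\<forall>w\<in>verts H. \<exists>v\<in>verts G. sat G (s(x := v)) A \<longleftrightarrow> sat H (t(x := w)) A)"
      by (rule quant[of A D x s t, OF Ex.IH]) (use Ex.prems in auto)
    then show ?case unfolding sat.simps by meson
  next
    case (All x A)
    have "(\<forall>v\<in>verts G. \<exists>w\<in>verts H. sat G (s(x := v)) A \<longleftrightarrow> sat H (t(x := w)) A) \<and>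
        (\<forall>w\<in>verts H. \<exists>v\<in>verts G. sat G (s(x := v)) A \<longleftrightarrow> sat H (t(x := w)) A)"
      by (rule quant[of A D x s t, OF All.IH]) (use All.prems in auto)
    then show ?case unfolding sat.simps by meson
  qed
qed

section \<open>Bounds on the logical depth of a single graph\<close>

lemma extension_property_depth:
  assumes "simple_graph G" "simple_graph H" "extension_property l G" "extension_property l H"
    and "\<not> graph_iso G H" "defines_graph A G"
  shows "Suc l < qdepth A"
proof (rule ccontr)
  assume "\<not> Suc l < qdepth A"
  then have "sat G s A \<longleftrightarrow> sat H t A" for s t
    using extension_property_sat_iff[OF assms(1-4), of "{}" A s t] assms(6)
    by (simp add: partial_iso_def defines_graph_def sentence_def)
  then show False using assms unfolding defines_graph_def models_def by blast
qed

lemma logical_depth_bounds: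
  assumes "simple_graph G" "simple_graph H" "extension_property l G" "extension_property l H"
    and "\<not> graph_iso G H"
    and "W \<subseteq> verts G" "weakly_sifting G W" "verts G \<noteq> {}"
  shows "l < logical_depth G" "logical_depth G \<le> card W + 3"
proof -
  obtain A where A: "defines_graph A G" "qdepth A \<le> card W + 3"
    using weakly_sifting_defines assms by blast
  then show "logical_depth G \<le> card W + 3"
    unfolding logical_depth_def
    using Least_le[of "\<lambda>k. \<exists>A. defines_graph A G \<and> qdepth A = k" "qdepth A"] by fastforce
  \<comment> \<open>The sentence found for the upper bound also shows that the minimum is attained;
    the lower bound is then applied to a sentence of minimal depth.\<close>
  obtain B where "defines_graph B G" "qdepth B = logical_depth G"
    using LeastI_ex[of "\<lambda>k. \<exists>A. defines_graph A G \<and> qdepth A = k"] A(1)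
    unfolding logical_depth_def by blast
  then show "l < logical_depth G"
    using extension_property_depth[OF assms(1-5)] by fastforce
qed

lemma graph_iso_card: "graph_iso G H \<Longrightarrow> card (verts G) = card (verts H)"
  unfolding graph_iso_def using bij_betw_same_card by blast

section \<open>Independence and second moments\<close>

definition determined_by :: "(('a \<Rightarrow> 'b) \<Rightarrow> bool) \<Rightarrow> 'a set \<Rightarrow> bool" where
  "determined_by P E \<longleftrightarrow> (\<forall>X Y. (\<forall>e\<in>E. X e = Y e) \<longrightarrow> (P X \<longleftrightarrow> P Y))"

lemma determined_byD: "determined_by P E \<Longrightarrow> (\<And>e. e \<in> E \<Longrightarrow> X e = Y e) \<Longrightarrow> P X \<longleftrightarrow> P Y"
  unfolding determined_by_def by blast

lemma determined_by_mono: "determined_by P E \<Longrightarrow> E \<subseteq> F \<Longrightarrow> determined_by P F"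
  unfolding determined_by_def by blast

text \<open>The product over \<open>I\<close> is the product over \<open>I \<inter> E\<close> and
  \<open>I - E\<close>; the first event is read from one factor and the second from the
  other.\<close>

lemma Pi_pmf_indep:
  assumes I: "finite I" and EF: "E \<inter> F = {}" and P: "determined_by P E" and Q: "determined_by Q F"
  shows "measure_pmf.prob (Pi_pmf I d p) {X. P X \<and> Q X} =
    measure_pmf.prob (Pi_pmf I d p) {X. P X} * measure_pmf.prob (Pi_pmf I d p) {X. Q X}"
proof -
  define A B where "A = I \<inter> E" and "B = I - E"
  let ?a = "measure_pmf.prob (Pi_pmf A d p)" and ?b = "measure_pmf.prob (Pi_pmf B d p)"
  have AB: "finite A" "finite B" "A \<inter> B = {}" "I = A \<union> B" using I by (auto simp: A_def B_def)
  \<comment> \<open>Kept general in both events, so that one of them can be replaced by the sure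
    event to identify the factors.\<close>
  have prod: "measure_pmf.prob (Pi_pmf I d p) {X. P' X \<and> Q' X} = ?a {X. P' X} * ?b {X. Q' X}"
    if P': "determined_by P' E" and Q': "determined_by Q' F" for P' Q'
  proof -
    let ?pair = "pair_pmf (Pi_pmf A d p) (Pi_pmf B d p)"
    let ?h = "\<lambda>(f, g) x. if x \<in> A then f x else g x"
    \<comment> \<open>Outside their index sets \<open>f\<close> and \<open>g\<close> take the
      default value \<open>d\<close>, so the merged function agrees with \<open>f\<close> on all of
      \<open>E\<close> and with \<open>g\<close> on all of \<open>F\<close>, even where these leave
      \<open>I\<close>.\<close>
    have "P' (?h (f, g)) \<and> Q' (?h (f, g)) \<longleftrightarrow> P' f \<and> Q' g"
      if "(f, g) \<in> set_pmf ?pair" for f g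
    proof -
      have "f x = d" if "x \<notin> A" for x
        using \<open>(f, g) \<in> set_pmf ?pair\<close> set_Pi_pmf_subset[OF AB(1), of d p] that by auto
      moreover have "g x = d" if "x \<notin> B" for x
        using \<open>(f, g) \<in> set_pmf ?pair\<close> set_Pi_pmf_subset[OF AB(2), of d p] that by auto
      ultimately have "P' (?h (f, g)) \<longleftrightarrow> P' f"
        by (intro determined_byD[OF P']) (auto simp: A_def B_def)
      moreover have "Q' (?h (f, g)) \<longleftrightarrow> Q' g"
        using EF by (intro determined_byD[OF Q']) (auto simp: A_def)
      ultimately show ?thesis by simp
    qed
    then have "measure_pmf.prob ?pair (?h -` {X. P' X \<and> Q' X}) =
        measure_pmf.prob ?pair (({X. P' X} \<inter> set_pmf (Pi_pmf A d p)) \<times> ({X. Q' X} \<inter> set_pmf (Pi_pmf B d p)))"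
      by (intro measure_pmf.finite_measure_eq_AE) (auto simp: AE_measure_pmf_iff)
    then show ?thesis
      unfolding AB(4) Pi_pmf_union[OF AB(1-3)]
      by (simp add: measure_pmf_prob_product measure_Int_set_pmf)
  qed
  have E: "determined_by (\<lambda>_. True) E" and F: "determined_by (\<lambda>_. True) F"
    by (simp_all add: determined_by_def)
  show ?thesis using prod[OF P Q] prod[OF P F] prod[OF E Q] by simp
qed

lemma determined_by_ball:
  fixes P :: "'c \<Rightarrow> ('a \<Rightarrow> 'b) \<Rightarrow> bool"
  assumes "\<And>u. u \<in> U \<Longrightarrow> determined_by (P u) F"
  shows "determined_by (\<lambda>X. \<forall>u\<in>U. P u X) F"
  unfolding determined_by_def
proof (intro allI impI ball_cong refl)
  fix X Y :: "'a \<Rightarrow> 'b" and u assume "\<forall>e\<in>F. X e = Y e" "u \<in> U"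
  then show "P u X \<longleftrightarrow> P u Y" using assms[of u] unfolding determined_by_def by simp
qed

lemma Pi_pmf_indep_family:
  assumes I: "finite I" and "finite U"
    and "\<And>u v. u \<in> U \<Longrightarrow> v \<in> U \<Longrightarrow> u \<noteq> v \<Longrightarrow> E u \<inter> E v = {}"
    and "\<And>u. u \<in> U \<Longrightarrow> determined_by (P u) (E u)"
  shows "measure_pmf.prob (Pi_pmf I d p) {X. \<forall>u\<in>U. P u X} =
    (\<Prod>u\<in>U. measure_pmf.prob (Pi_pmf I d p) {X. P u X})"
  using assms(2-)
proof (induction U rule: finite_induct)
  case empty
  then show ?case by simp
next
  case (insert u U)
  have "measure_pmf.prob (Pi_pmf I d p) {X. P u X \<and> (\<forall>v\<in>U. P v X)} =
      measure_pmf.prob (Pi_pmf I d p) {X. P u X} * measure_pmf.prob (Pi_pmf I d p) {X. \<forall>v\<in>U. P v X}"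
  proof (rule Pi_pmf_indep[OF I])
    show "E u \<inter> (\<Union>v\<in>U. E v) = {}" using insert.hyps insert.prems(1)[of u] by auto
    show "determined_by (P u) (E u)" using insert.prems by simp
    show "determined_by (\<lambda>X. \<forall>v\<in>U. P v X) (\<Union>v\<in>U. E v)"
    proof (rule determined_by_ball)
      fix v assume "v \<in> U"
      then have "determined_by (P v) (E v)" using insert.prems(2) by simp
      then show "determined_by (P v) (\<Union>v\<in>U. E v)"
        by (rule determined_by_mono) (use \<open>v \<in> U\<close> in blast)
    qed
  qed
  then show ?case using insert by simp
qed

section \<open>Elementary estimates and the second moment method\<close>

lemma prob_union_bound:
  assumes "finite U" "\<And>X. P X \<Longrightarrow> \<exists>u\<in>U. Q u X"
  shows "measure_pmf.prob M {X. P X} \<le> (\<Sum>u\<in>U. measure_pmf.prob M {X. Q u X})"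
proof -
  have "measure_pmf.prob M {X. P X} \<le> measure_pmf.prob M (\<Union>u\<in>U. {X. Q u X})"
    using assms(2) by (intro measure_pmf.finite_measure_mono) auto
  also have "\<dots> \<le> (\<Sum>u\<in>U. measure_pmf.prob M {X. Q u X})"
    by (rule measure_pmf.finite_measure_subadditive_finite[OF assms(1)]) auto
  finally show ?thesis .
qed

lemma prob_Not: "measure_pmf.prob M {X. \<not> P X} = 1 - measure_pmf.prob M {X. P X}"
  using measure_pmf.prob_compl[of "{X. P X}" M] by (simp add: set_diff_eq)

lemma prob_mono: "(\<And>X. P X \<Longrightarrow> Q X) \<Longrightarrow> measure_pmf.prob M {X. P X} \<le> measure_pmf.prob M {X. Q X}"
  by (rule measure_pmf.finite_measure_mono) auto

lemma expectation_of_bool: "measure_pmf.expectation M (\<lambda>X. of_bool (P X) :: real) = measure_pmf.prob M {X. P X}"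
proof -
  have "(\<lambda>X. of_bool (P X) :: real) = indicator {X. P X}" by (auto simp: indicator_def)
  then show ?thesis by simp
qed

lemma prob_Pi_bernoulli:
  assumes "finite I" "e \<in> I" "0 \<le> p" "p \<le> 1"
  shows "measure_pmf.prob (Pi_pmf I d (\<lambda>_. bernoulli_pmf p)) {X. X e = b} = (if b then p else 1 - p)"
proof -
  have "measure_pmf.prob (Pi_pmf I d (\<lambda>_. bernoulli_pmf p)) {X. X e = b} =
      measure_pmf.prob (map_pmf (\<lambda>X. X e) (Pi_pmf I d (\<lambda>_. bernoulli_pmf p))) {b}"
    by (simp add: vimage_def)
  also have "\<dots> = pmf (bernoulli_pmf p) b"
    using assms by (simp add: Pi_pmf_component pmf.rep_eq)
  finally show ?thesis using assms by (cases b) auto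
qed

text \<open>Chebyshev's inequality at distance \<open>\<mu> / 2\<close> from the mean. The factor
  \<open>c\<close> measures how far the pair probabilities may exceed independence; the variance is
  at most \<open>\<mu> + (c - 1) * \<mu>\<^sup>2\<close>.\<close>

lemma second_moment_lower_tail:
  fixes A :: "'j \<Rightarrow> 'a \<Rightarrow> bool" and M :: "'a pmf"
  assumes J: "finite J" "J \<noteq> {}" and a: "0 < a"
    and single: "\<And>i. i \<in> J \<Longrightarrow> measure_pmf.prob M {x. A i x} = a"
    and pair: "\<And>i j. i \<in> J \<Longrightarrow> j \<in> J \<Longrightarrow> i \<noteq> j \<Longrightarrow> measure_pmf.prob M {x. A i x \<and> A j x} \<le> c * a\<^sup>2"
    and c: "0 \<le> c"
  defines "\<mu> \<equiv> real (card J) * a"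
  shows "measure_pmf.prob M {x. real (card {i\<in>J. A i x}) \<le> \<mu> / 2} \<le> 4 / \<mu> + 4 * (c - 1)"
proof -
  define N where "N x = (\<Sum>i\<in>J. of_bool (A i x) :: real)" for x
  have N_card: "N x = real (card {i\<in>J. A i x})" for x
    using J(1) unfolding N_def by (simp add: sum_of_bool_eq Int_def)
  have bool_int: "integrable (measure_pmf M) (\<lambda>x. of_bool (P x) :: real)" for P
    by (rule measure_pmf.integrable_const_bound[where B = 1]) auto
  have N2: "(N x)\<^sup>2 = (\<Sum>i\<in>J. \<Sum>j\<in>J. of_bool (A i x \<and> A j x))" for x
    unfolding N_def power2_eq_square sum_product by (simp add: of_bool_conj)
  have int: "integrable (measure_pmf M) N" "integrable (measure_pmf M) (\<lambda>x. (N x)\<^sup>2)"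
    unfolding N2 by (auto simp: N_def[abs_def] intro!: Bochner_Integration.integrable_sum bool_int)
  have \<mu>: "\<mu> > 0" using J a by (simp add: \<mu>_def card_gt_0_iff)
  have EN: "measure_pmf.expectation M N = \<mu>"
    unfolding N_def[abs_def] \<mu>_def
    by (subst Bochner_Integration.integral_sum) (auto simp: bool_int expectation_of_bool single)
  have "measure_pmf.expectation M (\<lambda>x. (N x)\<^sup>2) =
      (\<Sum>i\<in>J. \<Sum>j\<in>J. measure_pmf.prob M {x. A i x \<and> A j x})"
    unfolding N2
    by (subst Bochner_Integration.integral_sum, simp add: bool_int)+ (simp add: bool_int expectation_of_bool)
  \<comment> \<open>In each row the diagonal term is \<open>a\<close>; the others are bounded by
    \<open>c * a\<^sup>2\<close> and their number is rounded up to \<open>card J\<close>.\<close>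
  also have "\<dots> \<le> (\<Sum>i\<in>J. a + real (card J) * (c * a\<^sup>2))"
  proof (rule sum_mono)
    fix i assume i: "i \<in> J"
    have "(\<Sum>j\<in>J. measure_pmf.prob M {x. A i x \<and> A j x}) =
        a + (\<Sum>j\<in>J - {i}. measure_pmf.prob M {x. A i x \<and> A j x})"
      using single[OF i] by (subst sum.remove[OF J(1) i]) (simp only: conj_absorb)
    also have "(\<Sum>j\<in>J - {i}. measure_pmf.prob M {x. A i x \<and> A j x}) \<le> (\<Sum>j\<in>J - {i}. c * a\<^sup>2)"
      using pair[OF i] by (intro sum_mono) auto
    also have "\<dots> \<le> (\<Sum>j\<in>J. c * a\<^sup>2)"
      using J(1) c by (intro sum_mono2) auto
    finally show "(\<Sum>j\<in>J. measure_pmf.prob M {x. A i x \<and> A j x}) \<le> a + real (card J) * (c * a\<^sup>2)" by simp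
  qed
  also have "\<dots> = \<mu> + c * \<mu>\<^sup>2" by (simp add: \<mu>_def algebra_simps power2_eq_square)
  finally have var: "measure_pmf.variance M N \<le> \<mu> + (c - 1) * \<mu>\<^sup>2"
    by (subst measure_pmf.variance_eq[OF int]) (simp add: EN algebra_simps)
  have "measure_pmf.prob M {x. N x \<le> \<mu> / 2} \<le> measure_pmf.prob M {x. \<mu> / 2 \<le> \<bar>N x - \<mu>\<bar>}"
    using \<mu> by (intro prob_mono) (simp add: abs_if field_simps)
  also have "\<dots> \<le> measure_pmf.variance M N / (\<mu> / 2)\<^sup>2"
    using measure_pmf.Chebyshev_inequality[of N M "\<mu> / 2"] int \<mu> by (simp add: EN)
  also have "\<dots> \<le> (\<mu> + (c - 1) * \<mu>\<^sup>2) / (\<mu> / 2)\<^sup>2"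
    using var by (intro divide_right_mono) auto
  also have "\<dots> = 4 / \<mu> + 4 * (c - 1)"
    using \<mu> by (simp add: field_simps power2_eq_square)
  finally show ?thesis by (simp add: N_card)
qed

section \<open>Adjacency patterns in the random graph\<close>

text \<open>The graph as a function of its edge indicators, so that probabilities can be computed in
  a product space.\<close>

definition graph_of :: "nat set \<Rightarrow> (nat set \<Rightarrow> bool) \<Rightarrow> ugraph" where
  "graph_of V X = \<lparr>verts = V, edges = {e \<in> vpairs V. X e}\<rparr>"

lemma verts_graph_of [simp]: "verts (graph_of V X) = V"
  by (simp add: graph_of_def)

lemma simple_graph_graph_of: "finite V \<Longrightarrow> simple_graph (graph_of V X)"
  by (auto simp: simple_graph_def graph_of_def)

lemma pair_in_vpairs: "{u, v} \<in> vpairs V \<longleftrightarrow> u \<in> V \<and> v \<in> V \<and> u \<noteq> v"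
  by (auto simp: vpairs_def card_2_iff)

lemma adjacent_graph_of: "adjacent (graph_of V X) u v \<longleftrightarrow> u \<in> V \<and> v \<in> V \<and> u \<noteq> v \<and> X {u, v}"
  unfolding adjacent_def graph_of_def using pair_in_vpairs[of u v V] by auto

lemma finite_vpairs: "finite V \<Longrightarrow> finite (vpairs V)"
  by (rule finite_subset[of _ "Pow V"]) (auto simp: vpairs_def)

text \<open>Stated on edge indicators, so that it visibly depends on the edges from \<open>v\<close>
  to \<open>W\<close> only; for \<open>v\<close> in \<open>V - W\<close> and
  \<open>W \<subseteq> V\<close> it describes the adjacencies of \<open>v\<close> to
  \<open>W\<close>.\<close>

definition row_pattern :: "nat set \<Rightarrow> nat \<Rightarrow> nat set \<Rightarrow> (nat set \<Rightarrow> bool) \<Rightarrow> bool" where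
  "row_pattern W v B X \<longleftrightarrow> (\<forall>w\<in>W. X {v, w} \<longleftrightarrow> w \<in> B)"

definition star_edges :: "nat set \<Rightarrow> nat \<Rightarrow> nat set set" where
  "star_edges W v = (\<lambda>w. {v, w}) ` W"

lemma star_edges_disjoint: "u \<noteq> v \<Longrightarrow> u \<notin> W \<Longrightarrow> v \<notin> W \<Longrightarrow> star_edges W u \<inter> star_edges W v = {}"
  by (auto simp: star_edges_def doubleton_eq_iff)

lemma determined_by_row_pattern: "determined_by (row_pattern W v B) (star_edges W v)"
  by (auto simp: determined_by_def row_pattern_def star_edges_def)

lemma determined_by_not: "determined_by P E \<Longrightarrow> determined_by (\<lambda>X. \<not> P X) E"
  by (simp add: determined_by_def)

lemma determined_by_disj: "determined_by P E \<Longrightarrow> determined_by Q E \<Longrightarrow> determined_by (\<lambda>X. P X \<or> Q X) E"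
  unfolding determined_by_def by (intro allI impI disj_cong) blast+

lemma determined_by_if:
  "(c \<Longrightarrow> determined_by P E) \<Longrightarrow> (\<not> c \<Longrightarrow> determined_by Q E) \<Longrightarrow>
    determined_by (\<lambda>X. if c then P X else Q X) E"
  by (cases c) simp_all

section \<open>Pattern probabilities and the extension property of the random graph\<close>

locale edge_space =
  fixes V :: "nat set" and p :: real
  assumes finite_V: "finite V" and p_pos: "0 < p" and p_less_1: "p < 1"
begin

abbreviation edge_pmf :: "(nat set \<Rightarrow> bool) pmf" where
  "edge_pmf \<equiv> Pi_pmf (vpairs V) False (\<lambda>_. bernoulli_pmf p)"

abbreviation pr :: "((nat set \<Rightarrow> bool) \<Rightarrow> bool) \<Rightarrow> real" where
  "pr P \<equiv> measure_pmf.prob edge_pmf {X. P X}"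

lemma pr_edge:
  assumes "u \<in> V" "v \<in> V" "u \<noteq> v"
  shows "pr (\<lambda>X. X {u, v} = b) = (if b then p else 1 - p)"
  using assms p_pos p_less_1 by (intro prob_Pi_bernoulli finite_vpairs finite_V) (auto simp: pair_in_vpairs)

lemmas pr_indep_family = Pi_pmf_indep_family[OF finite_vpairs[OF finite_V]]
lemmas pr_indep = Pi_pmf_indep[OF finite_vpairs[OF finite_V]]

lemma pr_row:
  assumes "v \<in> V" "v \<notin> W" "W \<subseteq> V" "B \<subseteq> W"
  shows "pr (row_pattern W v B) = p ^ card B * (1 - p) ^ (card W - card B)"
proof -
  have W: "finite W" using assms finite_V finite_subset by blast
  have "pr (row_pattern W v B) = (\<Prod>w\<in>W. pr (\<lambda>X. X {v, w} = (w \<in> B)))"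
    unfolding row_pattern_def
  proof (rule pr_indep_family[OF W])
    show "{{v, w}} \<inter> {{v, w'}} = {}" if "w \<noteq> w'" for w w' using that by (auto simp: doubleton_eq_iff)
  qed (auto simp: determined_by_def)
  also have "\<dots> = (\<Prod>w\<in>W. if w \<in> B then p else 1 - p)"
    using assms by (intro prod.cong refl pr_edge) auto
  also have "\<dots> = p ^ card (W \<inter> B) * (1 - p) ^ card (W - B)"
    by (subst prod.If_cases[OF W]) (simp add: Diff_eq Int_def)
  also have "\<dots> = p ^ card B * (1 - p) ^ (card W - card B)"
    using assms W by (simp add: Int_absorb1 card_Diff_subset finite_subset)
  finally show ?thesis .
qed

text \<open>Vertices outside \<open>A\<close> have disjoint stars to \<open>A\<close>, hence
  independent patterns. Each takes the pattern \<open>B\<close> with probability at least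
  \<open>p ^ card A\<close>, because \<open>p \<le> 1 - p\<close>; then
  \<open>1 - t \<le> exp (- t)\<close> is used.\<close>

lemma pr_no_row:
  assumes "A \<subseteq> V" "B \<subseteq> A" "p \<le> 1 / 2"
  shows "pr (\<lambda>X. \<forall>v\<in>V - A. \<not> row_pattern A v B X) \<le> exp (- (p ^ card A * real (card V - card A)))"
proof -
  have A: "finite A" using assms finite_V finite_subset by blast
  have "pr (\<lambda>X. \<forall>v\<in>V - A. \<not> row_pattern A v B X) = (\<Prod>v\<in>V - A. pr (\<lambda>X. \<not> row_pattern A v B X))"
    using finite_V by (intro pr_indep_family[where E = "star_edges A"] determined_by_not determined_by_row_pattern
      star_edges_disjoint) auto
  also have "\<dots> \<le> (\<Prod>v\<in>V - A. exp (- (p ^ card A)))"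
  proof (intro prod_mono conjI measure_nonneg)
    fix v assume v: "v \<in> V - A"
    have cB: "card B \<le> card A" using A assms by (simp add: card_mono)
    have "p ^ card A = p ^ card B * p ^ (card A - card B)" using cB by (simp flip: power_add)
    also have "\<dots> \<le> p ^ card B * (1 - p) ^ (card A - card B)"
      using assms p_pos by (intro mult_left_mono power_mono) auto
    finally have "1 - p ^ card B * (1 - p) ^ (card A - card B) \<le> 1 + (- (p ^ card A))" by simp
    also have "\<dots> \<le> exp (- (p ^ card A))" by (rule exp_ge_add_one_self)
    finally show "pr (\<lambda>X. \<not> row_pattern A v B X) \<le> exp (- (p ^ card A))"
      using v assms by (simp add: prob_Not pr_row)
  qed
  also have "\<dots> = exp (- (p ^ card A * real (card V - card A)))"
    using assms A by (simp add: card_Diff_subset mult.commute flip: exp_of_nat_mult)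
  finally show ?thesis .
qed

text \<open>A smaller set is enlarged to size \<open>l\<close> with \<open>B\<close> unchanged; a
  vertex that serves the larger set serves the smaller one.\<close>

lemma extension_property_graph_ofI:
  assumes "\<And>A B. A \<subseteq> V \<Longrightarrow> card A = l \<Longrightarrow> B \<subseteq> A \<Longrightarrow> \<exists>v\<in>V - A. row_pattern A v B X" and "l \<le> card V"
  shows "extension_property l (graph_of V X)"
  unfolding extension_property_def
proof (intro allI impI, elim conjE)
  fix A B assume AB: "B \<subseteq> A" "A \<subseteq> verts (graph_of V X)" "card A \<le> l"
  have "\<exists>A'. A \<subseteq> A' \<and> A' \<subseteq> V \<and> card A' = l"
    by (rule exists_subset_between) (use AB assms(2) finite_V in simp_all)
  then obtain A' where A': "A \<subseteq> A'" "A' \<subseteq> V" "card A' = l" by blast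
  then obtain v where "v \<in> V - A'" "row_pattern A' v B X" using assms(1)[of A' B] AB by auto
  then show "\<exists>v\<in>verts (graph_of V X) - A. \<forall>a\<in>A. adjacent (graph_of V X) v a \<longleftrightarrow> a \<in> B"
    using A' AB by (intro bexI[of _ v]) (force simp: adjacent_graph_of row_pattern_def)+
qed

text \<open>Union bound over at most \<open>card V ^ l\<close> sets of size \<open>l\<close> and
  \<open>2 ^ l\<close> patterns on each.\<close>

lemma pr_not_extension_property:
  assumes "p \<le> 1 / 2" "l \<le> card V"
  shows "pr (\<lambda>X. \<not> extension_property l (graph_of V X))
    \<le> (2 * real (card V)) ^ l * exp (- (p ^ l * real (card V - l)))"
proof -
  let ?e = "exp (- (p ^ l * real (card V - l)))"
  let ?S = "{A. A \<subseteq> V \<and> card A = l}"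
  have fin: "finite ?S" using finite_V by (auto intro: finite_subset[of _ "Pow V"])
  have "pr (\<lambda>X. \<not> extension_property l (graph_of V X))
      \<le> (\<Sum>A\<in>?S. pr (\<lambda>X. \<exists>B\<subseteq>A. \<forall>v\<in>V - A. \<not> row_pattern A v B X))"
  proof (intro prob_union_bound fin)
    fix X assume "\<not> extension_property l (graph_of V X)"
    then show "\<exists>A\<in>?S. \<exists>B\<subseteq>A. \<forall>v\<in>V - A. \<not> row_pattern A v B X"
      using extension_property_graph_ofI[OF _ assms(2), of X] by blast
  qed
  also have "\<dots> \<le> (\<Sum>A\<in>?S. 2 ^ l * ?e)"
  proof (rule sum_mono)
    fix A assume A: "A \<in> ?S"
    then have fA: "finite A" using finite_V finite_subset by blast
    have "pr (\<lambda>X. \<exists>B\<subseteq>A. \<forall>v\<in>V - A. \<not> row_pattern A v B X) \<le> (\<Sum>B\<in>Pow A. pr (\<lambda>X. \<forall>v\<in>V - A. \<not> row_pattern A v B X))"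
      using fA by (intro prob_union_bound) auto
    also have "\<dots> \<le> (\<Sum>B\<in>Pow A. ?e)"
      using A assms(1) pr_no_row[of A] by (intro sum_mono) auto
    also have "\<dots> = 2 ^ l * ?e" using fA A by (simp add: card_Pow)
    finally show "pr (\<lambda>X. \<exists>B\<subseteq>A. \<forall>v\<in>V - A. \<not> row_pattern A v B X) \<le> 2 ^ l * ?e" .
  qed
  also have "\<dots> = real (card V choose l) * (2 ^ l * ?e)"
    using n_subsets[OF finite_V, of l] by simp
  also have "\<dots> \<le> real (card V ^ l) * (2 ^ l * ?e)"
    using binomial_le_pow[OF assms(2)] by (intro mult_right_mono) (simp_all flip: of_nat_power)
  finally show ?thesis by (simp add: power_mult_distrib mult_ac)
qed

end

section \<open>Vertices alone in their adjacency pattern\<close>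

lemma row_pattern_unique:
  "row_pattern W v B X \<Longrightarrow> row_pattern W v B' X \<Longrightarrow> B \<subseteq> W \<Longrightarrow> B' \<subseteq> W \<Longrightarrow> B = B'"
  unfolding row_pattern_def by blast

context edge_space
begin

definition unique_row :: "nat set \<Rightarrow> nat \<Rightarrow> nat set \<Rightarrow> (nat set \<Rightarrow> bool) \<Rightarrow> bool" where
  "unique_row W v B X \<longleftrightarrow> row_pattern W v B X \<and> (\<forall>u\<in>V - W - {v}. \<not> row_pattern W u B X)"

lemma pr_rows:
  assumes "\<And>u. u \<in> V - W \<Longrightarrow> determined_by (P u) (star_edges W u)"
  shows "pr (\<lambda>X. \<forall>u\<in>V - W. P u X) = (\<Prod>u\<in>V - W. pr (P u))"
  using finite_V assms
  by (intro pr_indep_family[where E = "star_edges W"] star_edges_disjoint) auto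

lemma pr_unique_row:
  assumes "W \<subseteq> V" "v \<in> V - W" "B \<subseteq> W"
  shows "pr (unique_row W v B) = pr (row_pattern W v B) * (1 - pr (row_pattern W v B)) ^ (card (V - W) - 1)"
proof -
  let ?P = "\<lambda>u X. if u = v then row_pattern W u B X else \<not> row_pattern W u B X"
  have same: "pr (row_pattern W u B) = pr (row_pattern W v B)" if "u \<in> V - W" for u
    using that assms by (simp add: pr_row)
  have "unique_row W v B X \<longleftrightarrow> (\<forall>u\<in>V - W. ?P u X)" for X
    using assms(2) by (auto simp: unique_row_def)
  then have "pr (unique_row W v B) = pr (\<lambda>X. \<forall>u\<in>V - W. ?P u X)" by presburger
  also have "\<dots> = (\<Prod>u\<in>V - W. pr (?P u))"
    by (intro pr_rows determined_by_if determined_by_not determined_by_row_pattern)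
  also have "\<dots> = pr (?P v) * (\<Prod>u\<in>V - W - {v}. pr (?P u))"
    using assms finite_V by (intro prod.remove) auto
  also have "(\<Prod>u\<in>V - W - {v}. pr (?P u)) = (\<Prod>u\<in>V - W - {v}. 1 - pr (row_pattern W v B))"
    using same by (intro prod.cong) (auto simp: prob_Not)
  finally show ?thesis using assms finite_V by (simp add: card_Diff_singleton)
qed

text \<open>If exactly one of the vertices and the patterns differ, the events exclude each other.
  Otherwise, with \<open>q\<close> the probability of one pattern, every remaining vertex avoids
  both with probability \<open>1 - 2 * q \<le> (1 - q) ^ 2\<close>. The bound exceeds the square of
  the single probability only by the factor \<open>1 / (1 - q)\<^sup>2\<close>.\<close>

lemma pr_unique_row_pair:
  assumes W: "W \<subseteq> V" and v: "v \<in> V - W" "v' \<in> V - W" and B: "B \<subseteq> W" "B' \<subseteq> W" "card B' = card B"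
    and ne: "(v, B) \<noteq> (v', B')"
  shows "pr (\<lambda>X. unique_row W v B X \<and> unique_row W v' B' X) \<le>
    pr (row_pattern W v B) ^ 2 * ((1 - pr (row_pattern W v B)) ^ 2) ^ (card (V - W) - 2)"
proof (cases "v \<noteq> v' \<and> B \<noteq> B'")
  case False
  then have "\<not> (unique_row W v B X \<and> unique_row W v' B' X)" for X
    using ne v B row_pattern_unique[of W v B X B'] unfolding unique_row_def by auto
  then have "{X. unique_row W v B X \<and> unique_row W v' B' X} = {}" by blast
  then show ?thesis by (simp only:) simp
next
  case True
  let ?q = "pr (row_pattern W v B)"
  let ?P = "\<lambda>u X. if u = v then row_pattern W u B X else if u = v' then row_pattern W u B' X
    else \<not> (row_pattern W u B X \<or> row_pattern W u B' X)"
  have same: "pr (row_pattern W u B) = ?q" "pr (row_pattern W u B') = ?q" if "u \<in> V - W" for u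
    using that assms by (simp_all add: pr_row)
  have rest: "pr (\<lambda>X. \<not> (row_pattern W u B X \<or> row_pattern W u B' X)) = 1 - 2 * ?q" if u: "u \<in> V - W" for u
  proof -
    have "pr (\<lambda>X. row_pattern W u B X \<or> row_pattern W u B' X) =
        measure_pmf.prob edge_pmf ({X. row_pattern W u B X} \<union> {X. row_pattern W u B' X})"
      by (rule arg_cong[where f = "measure_pmf.prob edge_pmf"]) auto
    also have "\<dots> = pr (row_pattern W u B) + pr (row_pattern W u B')"
      using row_pattern_unique[OF _ _ B(1,2)] True
      by (intro measure_pmf.finite_measure_Union) auto
    finally show ?thesis using same[OF u] unfolding prob_Not by simp
  qed
  have "pr (\<lambda>X. unique_row W v B X \<and> unique_row W v' B' X) \<le> pr (\<lambda>X. \<forall>u\<in>V - W. ?P u X)"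
    using v by (intro prob_mono) (auto simp: unique_row_def)
  also have "\<dots> = (\<Prod>u\<in>V - W. pr (?P u))"
    by (intro pr_rows determined_by_if determined_by_not determined_by_disj determined_by_row_pattern)
  also have "\<dots> = pr (?P v) * (pr (?P v') * (\<Prod>u\<in>V - W - {v} - {v'}. pr (?P u)))"
    using v finite_V True by (subst prod.remove[of _ v], simp, simp, subst prod.remove[of _ v']) auto
  also have "(\<Prod>u\<in>V - W - {v} - {v'}. pr (?P u)) = (\<Prod>u\<in>V - W - {v} - {v'}. 1 - 2 * ?q)"
    using rest by (intro prod.cong) auto
  also have "\<dots> = (1 - 2 * ?q) ^ (card (V - W) - 2)"
    using v finite_V True by (simp add: card_Diff_singleton numeral_2_eq_2)
  also have "pr (?P v) = ?q" by simp
  also have "pr (?P v') = ?q" using same(2)[OF v(2)] True by simp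
  also have "?q * (?q * (1 - 2 * ?q) ^ (card (V - W) - 2)) \<le> ?q * (?q * ((1 - ?q) ^ 2) ^ (card (V - W) - 2))"
  proof (intro mult_left_mono power_mono measure_nonneg)
    show "1 - 2 * ?q \<le> (1 - ?q) ^ 2" by (simp add: power2_eq_square algebra_simps)
    show "0 \<le> 1 - 2 * ?q" using rest[OF v(1)] measure_nonneg by metis
  qed
  also have "\<dots> = ?q ^ 2 * ((1 - ?q) ^ 2) ^ (card (V - W) - 2)"
    by (simp only: power2_eq_square mult.assoc)
  finally show ?thesis .
qed

text \<open>A vertex has only one pattern, so counting pairs of a vertex and its unshared pattern
  counts vertices, and each of these is sifted.\<close>

lemma card_unique_row_le:
  assumes "W \<subseteq> V"
  shows "card {i \<in> (V - W) \<times> {B. B \<subseteq> W \<and> card B = k}. unique_row W (fst i) (snd i) X}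
    \<le> card (sifted (graph_of V X) W)"
proof (rule card_inj_on_le[of fst])
  show "inj_on fst {i \<in> (V - W) \<times> {B. B \<subseteq> W \<and> card B = k}. unique_row W (fst i) (snd i) X}"
    by (rule inj_onI) (auto simp: unique_row_def dest: row_pattern_unique)
  have "v \<in> sifted (graph_of V X) W" if "v \<in> V - W" "B \<subseteq> W" "unique_row W v B X" for v B
    unfolding sifted_def
  proof (clarsimp simp: that(1)[simplified], rule ccontr)
    fix u assume u: "u \<in> V" "u \<notin> W" "u \<noteq> v"
      and adj: "\<forall>w\<in>W. adjacent (graph_of V X) u w \<longleftrightarrow> adjacent (graph_of V X) v w"
    have "X {u, w} \<longleftrightarrow> X {v, w}" if "w \<in> W" for w
      using adj u that \<open>v \<in> V - W\<close> assms by (auto simp: adjacent_graph_of)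
    then have "row_pattern W u B X"
      using that(3) by (simp add: unique_row_def row_pattern_def)
    then show False using that(3) u by (auto simp: unique_row_def)
  qed
  then show "fst ` {i \<in> (V - W) \<times> {B. B \<subseteq> W \<and> card B = k}. unique_row W (fst i) (snd i) X}
      \<subseteq> sifted (graph_of V X) W" by auto
  show "finite (sifted (graph_of V X) W)" using finite_V by (auto simp: sifted_def)
qed

text \<open>Here \<open>r\<close> is the probability that a given vertex has a given pattern of size
  \<open>k\<close>, and \<open>\<mu>\<close> is the expected number of vertices alone in a pattern
  of that size.\<close>

lemma pr_few_sifted:
  assumes W: "W \<subseteq> V" and k: "k \<le> card W" and m: "2 \<le> card (V - W)"
  defines "r \<equiv> p ^ k * (1 - p) ^ (card W - k)"
  defines "\<mu> \<equiv> real (card (V - W) * (card W choose k)) * (r * (1 - r) ^ (card (V - W) - 1))"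
  assumes r: "r < 1"
  shows "pr (\<lambda>X. real (card (sifted (graph_of V X) W)) \<le> \<mu> / 2) \<le> 4 / \<mu> + 4 * (1 / (1 - r)\<^sup>2 - 1)"
proof -
  let ?J = "(V - W) \<times> {B. B \<subseteq> W \<and> card B = k}"
  let ?m = "card (V - W)"
  let ?a = "r * (1 - r) ^ (?m - 1)"
  have fW: "finite W" using W finite_V finite_subset by blast
  have r0: "0 < r" using p_pos p_less_1 by (simp add: r_def)
  have cardJ: "card ?J = ?m * (card W choose k)"
    using n_subsets[OF fW] by (simp add: card_cartesian_product)
  have fJ: "finite ?J" using fW finite_V by (auto intro: finite_subset[of _ "Pow W"])
  have "card ?J > 0" using cardJ m k by (simp add: zero_less_binomial)
  then have neJ: "?J \<noteq> {}" by (metis card.empty less_irrefl)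
  have row: "pr (row_pattern W v B) = r" if "(v, B) \<in> ?J" for v B
    using that W by (auto simp: pr_row r_def)
  have "pr (\<lambda>X. real (card (sifted (graph_of V X) W)) \<le> \<mu> / 2) \<le>
      pr (\<lambda>X. real (card {i \<in> ?J. unique_row W (fst i) (snd i) X}) \<le> \<mu> / 2)"
    using card_unique_row_le[OF W] by (intro prob_mono) (meson of_nat_mono order_trans)
  also have "\<dots> \<le> 4 / \<mu> + 4 * (1 / (1 - r)\<^sup>2 - 1)"
    unfolding \<mu>_def cardJ[symmetric]
  proof (rule second_moment_lower_tail[OF fJ neJ])
    show "0 < ?a" using r r0 by simp
    show "0 \<le> 1 / (1 - r)\<^sup>2" by simp
  next
    fix i assume i: "i \<in> ?J"
    then show "pr (unique_row W (fst i) (snd i)) = ?a"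
      using pr_unique_row[OF W, of "fst i" "snd i"] row[of "fst i" "snd i"] by auto
  next
    fix i j assume ij: "i \<in> ?J" "j \<in> ?J" "i \<noteq> j"
    have "pr (\<lambda>X. unique_row W (fst i) (snd i) X \<and> unique_row W (fst j) (snd j) X) \<le> r ^ 2 * ((1 - r) ^ 2) ^ (?m - 2)"
      using pr_unique_row_pair[OF W, of "fst i" "fst j" "snd i" "snd j"] row[of "fst i" "snd i"] ij
      by (auto simp: prod_eq_iff)
    also have "\<dots> = 1 / (1 - r)\<^sup>2 * ?a\<^sup>2"
    proof -
      have "?m - 1 = Suc (?m - 2)" using m by simp
      then have "?a\<^sup>2 = r ^ 2 * (((1 - r) ^ 2) ^ (?m - 2) * (1 - r)\<^sup>2)"
        by (simp add: power_mult_distrib power2_eq_square mult_ac)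
      then show ?thesis using r by simp
    qed
    finally show "pr (\<lambda>X. unique_row W (fst i) (snd i) X \<and> unique_row W (fst j) (snd j) X) \<le> 1 / (1 - r)\<^sup>2 * ?a\<^sup>2" .
  qed
  finally show ?thesis .
qed

text \<open>Two independent edges agree with probability \<open>p\<^sup>2 + (1 - p)\<^sup>2\<close>,
  and different \<open>w\<close> involve disjoint pairs of edges.\<close>

lemma pr_agree:
  assumes "u \<in> V" "v \<in> V" "u \<noteq> v" "S \<subseteq> V" "u \<notin> S" "v \<notin> S"
  shows "pr (\<lambda>X. \<forall>w\<in>S. X {u, w} \<longleftrightarrow> X {v, w}) = (p\<^sup>2 + (1 - p)\<^sup>2) ^ card S"
proof -
  have S: "finite S" using assms finite_V finite_subset by blast
  have one: "pr (\<lambda>X. X {u, w} \<longleftrightarrow> X {v, w}) = p\<^sup>2 + (1 - p)\<^sup>2" if w: "w \<in> S" for w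
  proof -
    have ne: "{{u, w}} \<inter> {{v, w}} = {}" using assms by (auto simp: doubleton_eq_iff)
    have w': "w \<in> V" "u \<noteq> w" "v \<noteq> w" using assms w by auto
    have both: "pr (\<lambda>X. X {u, w} = b \<and> X {v, w} = b) = (if b then p else 1 - p)\<^sup>2" for b
      by (subst pr_indep[OF ne])
        (use pr_edge[OF assms(1) w'(1,2), of b] pr_edge[OF assms(2) w'(1,3), of b]
          in \<open>simp_all add: determined_by_def power2_eq_square\<close>)
    have "pr (\<lambda>X. X {u, w} \<longleftrightarrow> X {v, w}) = measure_pmf.prob edge_pmf
        ({X. X {u, w} = True \<and> X {v, w} = True} \<union> {X. X {u, w} = False \<and> X {v, w} = False})"
      by (rule arg_cong[where f = "measure_pmf.prob edge_pmf"]) auto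
    also have "\<dots> = pr (\<lambda>X. X {u, w} = True \<and> X {v, w} = True) + pr (\<lambda>X. X {u, w} = False \<and> X {v, w} = False)"
      by (intro measure_pmf.finite_measure_Union) auto
    finally show ?thesis unfolding both by simp
  qed
  have "pr (\<lambda>X. \<forall>w\<in>S. X {u, w} \<longleftrightarrow> X {v, w}) = (\<Prod>w\<in>S. pr (\<lambda>X. X {u, w} \<longleftrightarrow> X {v, w}))"
  proof (rule pr_indep_family[OF S])
    show "{{u, w}, {v, w}} \<inter> {{u, w'}, {v, w'}} = {}" if "w \<in> S" "w' \<in> S" "w \<noteq> w'" for w w'
      using that assms by (auto simp: doubleton_eq_iff)
  qed (auto simp: determined_by_def)
  then show ?thesis using one by simp
qed

text \<open>The event is split by the value \<open>S\<close> of the sifted set. For fixed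
  \<open>S\<close>, a union bound over pairs of vertices outside \<open>S\<close> that agree on
  \<open>S\<close> applies; the probabilities of the values of \<open>S\<close> add up to at most
  1.\<close>

lemma pr_not_weakly_sifting:
  assumes W: "W \<subseteq> V"
  shows "pr (\<lambda>X. \<not> weakly_sifting (graph_of V X) W \<and> L \<le> card (sifted (graph_of V X) W))
    \<le> (real (card V))\<^sup>2 * (p\<^sup>2 + (1 - p)\<^sup>2) ^ L"
proof -
  let ?\<rho> = "p\<^sup>2 + (1 - p)\<^sup>2"
  let ?U = "V - W"
  let ?sift = "\<lambda>X. sifted (graph_of V X) W"
  define Q where "Q S X \<longleftrightarrow> (\<exists>uv\<in>?U \<times> ?U. fst uv \<notin> S \<and> snd uv \<notin> S \<and> fst uv \<noteq> snd uv \<and>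
    (\<forall>w\<in>S. X {fst uv, w} \<longleftrightarrow> X {snd uv, w}))" for S X
  let ?F = "{S. S \<subseteq> ?U \<and> L \<le> card S}"
  have "?\<rho> = 1 - 2 * (p * (1 - p))" by (simp add: power2_eq_square algebra_simps)
  moreover have "0 \<le> p\<^sup>2 + (1 - p)\<^sup>2" "0 \<le> p * (1 - p)"
    using p_pos p_less_1 by (simp_all add: mult_nonneg_nonneg)
  ultimately have \<rho>: "0 \<le> ?\<rho>" "?\<rho> \<le> 1" by linarith+
  have sub: "?sift X \<subseteq> ?U" for X by (auto simp: sifted_def)
  have fF: "finite ?F" using finite_V by (auto intro: finite_subset[of _ "Pow V"])
  have QD: "Q (?sift X) X" if "\<not> weakly_sifting (graph_of V X) W" for X
  proof (rule ccontr)
    assume Q: "\<not> Q (?sift X) X"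
    have "weakly_sifting (graph_of V X) W"
    proof (rule weakly_siftingI, rule ccontr)
      fix u v assume *: "u \<in> verts (graph_of V X) - W - ?sift X" "v \<in> verts (graph_of V X) - W - ?sift X"
        "\<forall>w\<in>?sift X. adjacent (graph_of V X) u w \<longleftrightarrow> adjacent (graph_of V X) v w" "u \<noteq> v"
      have "X {u, w} \<longleftrightarrow> X {v, w}" if "w \<in> ?sift X" for w
        using * that sub[of X] by (auto simp: adjacent_graph_of)
      then have "Q (?sift X) X"
        unfolding Q_def using * by (intro bexI[of _ "(u, v)"]) simp_all
      then show False using Q by simp
    qed
    then show False using that by simp
  qed
  have prQ: "pr (Q S) \<le> (real (card V))\<^sup>2 * ?\<rho> ^ L" if S: "S \<in> ?F" for S
  proof -
    have "pr (Q S) \<le> (\<Sum>uv\<in>?U \<times> ?U. pr (\<lambda>X. fst uv \<notin> S \<and> snd uv \<notin> S \<and> fst uv \<noteq> snd uv \<and>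
        (\<forall>w\<in>S. X {fst uv, w} \<longleftrightarrow> X {snd uv, w})))"
      using finite_V by (intro prob_union_bound) (auto simp: Q_def)
    also have "\<dots> \<le> (\<Sum>uv\<in>?U \<times> ?U. ?\<rho> ^ L)"
    proof (rule sum_mono)
      fix uv assume uv: "uv \<in> ?U \<times> ?U"
      show "pr (\<lambda>X. fst uv \<notin> S \<and> snd uv \<notin> S \<and> fst uv \<noteq> snd uv \<and>
          (\<forall>w\<in>S. X {fst uv, w} \<longleftrightarrow> X {snd uv, w})) \<le> ?\<rho> ^ L"
      proof (cases "fst uv \<notin> S \<and> snd uv \<notin> S \<and> fst uv \<noteq> snd uv")
        case True
        then have "pr (\<lambda>X. \<forall>w\<in>S. X {fst uv, w} \<longleftrightarrow> X {snd uv, w}) = ?\<rho> ^ card S"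
          using uv S by (intro pr_agree) auto
        also have "\<dots> \<le> ?\<rho> ^ L" using S \<rho> by (intro power_decreasing) auto
        finally show ?thesis using True by simp
      next
        case False
        then have "{X. fst uv \<notin> S \<and> snd uv \<notin> S \<and> fst uv \<noteq> snd uv \<and>
          (\<forall>w\<in>S. X {fst uv, w} \<longleftrightarrow> X {snd uv, w})} = {}" by blast
        then show ?thesis using zero_le_power[OF \<rho>(1), of L] by (simp only: measure_empty)
      qed
    qed
    also have "\<dots> = (real (card ?U))\<^sup>2 * ?\<rho> ^ L"
      by (simp add: card_cartesian_product power2_eq_square)
    also have "\<dots> \<le> (real (card V))\<^sup>2 * ?\<rho> ^ L"
      using \<rho> finite_V by (intro mult_right_mono power_mono) (auto simp: card_mono)
    finally show ?thesis .
  qed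
  \<comment> \<open>The sifted set depends only on the edges between \<open>W\<close> and its complement, \<open>Q\<close> only on edges
    inside the complement.\<close>
  have indep: "pr (\<lambda>X. ?sift X = S \<and> Q S X) = pr (\<lambda>X. ?sift X = S) * pr (Q S)" if S: "S \<in> ?F" for S
  proof (rule pr_indep)
    show "(\<Union>v\<in>?U. star_edges W v) \<inter> (\<Union>v\<in>?U. star_edges ?U v) = {}"
      by (auto simp: star_edges_def doubleton_eq_iff)
    show "determined_by (\<lambda>X. ?sift X = S) (\<Union>v\<in>?U. star_edges W v)"
      unfolding determined_by_def
    proof (intro allI impI)
      fix X Y :: "nat set \<Rightarrow> bool" assume "\<forall>e\<in>\<Union>v\<in>?U. star_edges W v. X e = Y e"
      then have eq: "adjacent (graph_of V X) v w \<longleftrightarrow> adjacent (graph_of V Y) v w" if "v \<in> ?U" "w \<in> W" for v w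
        using that by (auto simp: adjacent_graph_of star_edges_def)
      have "?sift X = ?sift Y" unfolding sifted_def
        by (intro Collect_cong conj_cong ball_cong imp_cong) (simp_all add: eq)
      then show "?sift X = S \<longleftrightarrow> ?sift Y = S" by simp
    qed
    show "determined_by (Q S) (\<Union>v\<in>?U. star_edges ?U v)"
      unfolding determined_by_def
    proof (intro allI impI)
      fix X Y :: "nat set \<Rightarrow> bool" assume "\<forall>e\<in>\<Union>v\<in>?U. star_edges ?U v. X e = Y e"
      then have eq: "X {v, w} \<longleftrightarrow> Y {v, w}" if "v \<in> ?U" "w \<in> S" for v w
        using that S by (auto simp: star_edges_def)
      show "Q S X \<longleftrightarrow> Q S Y" unfolding Q_def
        by (intro bex_cong refl conj_cong ball_cong) (auto simp: eq)
    qed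
  qed
  have "pr (\<lambda>X. \<not> weakly_sifting (graph_of V X) W \<and> L \<le> card (?sift X)) \<le> (\<Sum>S\<in>?F. pr (\<lambda>X. ?sift X = S \<and> Q S X))"
    using QD sub by (intro prob_union_bound fF) auto
  also have "\<dots> \<le> (\<Sum>S\<in>?F. pr (\<lambda>X. ?sift X = S) * ((real (card V))\<^sup>2 * ?\<rho> ^ L))"
    using indep prQ by (intro sum_mono) (simp add: mult_left_mono)
  also have "\<dots> = (\<Sum>S\<in>?F. pr (\<lambda>X. ?sift X = S)) * ((real (card V))\<^sup>2 * ?\<rho> ^ L)"
    by (simp add: sum_distrib_right)
  also have "(\<Sum>S\<in>?F. pr (\<lambda>X. ?sift X = S)) = measure_pmf.prob edge_pmf (\<Union>S\<in>?F. {X. ?sift X = S})"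
    using fF by (intro measure_pmf.finite_measure_finite_Union[symmetric]) (auto simp: disjoint_family_on_def)
  also have "\<dots> * ((real (card V))\<^sup>2 * ?\<rho> ^ L) \<le> 1 * ((real (card V))\<^sup>2 * ?\<rho> ^ L)"
    using \<rho> by (intro mult_right_mono) auto
  finally show ?thesis by simp
qed

end

section \<open>Asymptotics\<close>

lemma powr_log_inverse_base:
  assumes "0 < p" "p < 1" "0 < x"
  shows "p powr (log (1 / p) x) = 1 / (x::real)"
proof -
  have "p powr (log (1 / p) x) = (1 / p) powr (- log (1 / p) x)"
    using assms by (simp add: powr_minus powr_divide)
  also have "\<dots> = 1 / x" using assms by (simp add: powr_minus divide_inverse)
  finally show ?thesis .
qed

text \<open>Omitting two vertices gives about \<open>(ln n)^2\<close> patterns, so that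
  \<open>\<rho>\<close> to a constant multiple of this power beats the \<open>n^2\<close> pairs for
  every constant. Omitting one would give only order \<open>ln n\<close>, hence just some power of
  \<open>n\<close>.\<close>

lemma pr_not_weakly_sifting_tendsto_0:
  fixes p :: real
  assumes p: "0 < p" "p \<le> 1 / 2"
  defines "s \<equiv> \<lambda>n. nat \<lceil>log (1 / p) (real n)\<rceil>"
  obtains f :: "nat \<Rightarrow> real" where "f \<longlonglongrightarrow> 0"
    "\<forall>\<^sub>F n in sequentially. measure_pmf.prob (Pi_pmf (vpairs {1..n}) False (\<lambda>_. bernoulli_pmf p))
      {X. \<not> weakly_sifting (graph_of {1..n} X) {1..s n}} \<le> f n"
proof -
  define \<beta> where "\<beta> = ln (1 / p)"
  have \<beta>: "0 < \<beta>" using p by (simp add: \<beta>_def)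
  \<comment> \<open>A vertex takes a given pattern omitting two of the \<open>s n\<close> vertices with probability between
    \<open>c1 / n\<close> and \<open>c2 / n\<close>, so about \<open>c (log n)\<^sup>2\<close> patterns are taken exactly once.\<close>
  define c1 c2 where "c1 = (1 - p)\<^sup>2 / p" and "c2 = (1 - p)\<^sup>2 / p\<^sup>2"
  define c where "c = c1 * exp (- c2) / 16"
  have c0: "0 < c1" "0 < c2" "0 < c" using p by (simp_all add: c1_def c2_def c_def)
  define \<rho> where "\<rho> = p\<^sup>2 + (1 - p)\<^sup>2"
  have "\<rho> = 1 - 2 * (p * (1 - p))" by (simp add: \<rho>_def power2_eq_square algebra_simps)
  moreover have "0 < p * (1 - p)" using p by simp
  moreover have "0 < \<rho>" using p by (simp add: \<rho>_def add_pos_nonneg)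
  ultimately have \<rho>: "0 < \<rho>" "\<rho> < 1" by linarith+
  define \<gamma> where "\<gamma> = - ln \<rho>"
  have \<gamma>: "0 < \<gamma>" using \<rho> by (simp add: \<gamma>_def)
  \<comment> \<open>The first two terms come from the second moment bound, the last from pairs left
    unseparated by at least \<open>c * x\<^sup>2 / 2 - 1\<close> sifted vertices, where
    \<open>x = ln n / \<beta>\<close>.\<close>
  define f where "f n = 4 / (c * (ln (real n) / \<beta>)\<^sup>2) + 4 * (1 / (1 - c2 / real n)\<^sup>2 - 1) +
    (real n)\<^sup>2 * exp (- \<gamma> * (c * (ln (real n) / \<beta>)\<^sup>2 / 2 - 1))" for n
  have "f \<longlonglongrightarrow> 0"
  proof -
    have "(\<lambda>n. 4 / (c * (ln (real n) / \<beta>)\<^sup>2)) \<longlonglongrightarrow> 0" using c0 \<beta> by real_asymp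
    moreover have "(\<lambda>n. 4 * (1 / (1 - c2 / real n)\<^sup>2 - 1)) \<longlonglongrightarrow> 0" using c0 by real_asymp
    moreover have "(\<lambda>n. (real n)\<^sup>2 * exp (- \<gamma> * (c * (ln (real n) / \<beta>)\<^sup>2 / 2 - 1))) \<longlonglongrightarrow> 0"
      using c0 \<beta> \<gamma> by real_asymp
    ultimately show ?thesis unfolding f_def[abs_def] by (auto intro: tendsto_eq_intros)
  qed
  moreover have "\<forall>\<^sub>F n in sequentially. measure_pmf.prob (Pi_pmf (vpairs {1..n}) False (\<lambda>_. bernoulli_pmf p))
      {X. \<not> weakly_sifting (graph_of {1..n} X) {1..s n}} \<le> f n"
  proof -
    \<comment> \<open>This keeps the probability that no other vertex takes the same pattern away
      from 0.\<close>
    have "(\<lambda>n. (1 + (- c2) / real n) ^ n) \<longlonglongrightarrow> exp (- c2)"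
      by (rule tendsto_exp_limit_sequentially)
    then have ev1: "\<forall>\<^sub>F n in sequentially. exp (- c2) / 2 < (1 + (- c2) / real n) ^ n"
      by (rule order_tendstoD(1)) simp
    have ev2: "\<forall>\<^sub>F n in sequentially. 4 < ln (real n) / \<beta>" using \<beta> by real_asymp
    have ev3: "\<forall>\<^sub>F n in sequentially. ln (real n) / \<beta> + 1 < real n / 2" using \<beta> by real_asymp
    have ev4: "\<forall>\<^sub>F n in sequentially. c2 / real n < 1" using c0 by real_asymp
    have ev5: "\<forall>\<^sub>F n in sequentially. 8 \<le> n" by (rule eventually_ge_at_top)
    show ?thesis using ev1 ev2 ev3 ev4 ev5
    proof eventually_elim
      case (elim n)
      define x where "x = ln (real n) / \<beta>"
      have x: "log (1 / p) (real n) = x" by (simp add: log_def x_def \<beta>_def)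
      have x4: "4 < x" and xn: "x + 1 < real n / 2" using elim by (simp_all add: x_def)
      have n: "8 \<le> n" by fact
      have s: "x \<le> real (s n)" "real (s n) \<le> x + 1"
        using x4 unfolding s_def x by linarith+
      let ?W = "{1..s n}" and ?V = "{1..n}"
      interpret edge_space ?V p
        using p by unfold_locales auto
      have sn: "4 \<le> s n" "2 * s n \<le> n" using s x4 xn by linarith+
      have W: "?W \<subseteq> ?V" using sn by auto
      have cardU: "card (?V - ?W) = n - s n"
        using card_Diff_subset[of ?W ?V] W by simp
      define r where "r = p ^ (s n - 2) * (1 - p) ^ (card ?W - (s n - 2))"
      define \<mu> where "\<mu> = real (card (?V - ?W) * (card ?W choose (s n - 2))) * (r * (1 - r) ^ (card (?V - ?W) - 1))"
      have r: "r = p ^ s n * ((1 - p)\<^sup>2 / p\<^sup>2)"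
      proof -
        have "s n - 2 + 2 = s n" using sn by linarith
        then have "p ^ s n = p ^ (s n - 2) * p\<^sup>2" by (metis power_add)
        then show ?thesis using sn p by (simp add: r_def)
      qed
      have px: "p powr x = 1 / real n"
        using powr_log_inverse_base[of p "real n"] p n x by simp
      \<comment> \<open>Rounding the logarithm up costs at most a factor \<open>p\<close>:
        \<open>p ^ s n\<close> lies between \<open>p / n\<close> and \<open>1 / n\<close>, which
        yields \<open>c1\<close> and \<open>c2\<close>.\<close>
      have "p ^ s n \<le> p powr x"
        using p s powr_mono'[of x "real (s n)" p] by (simp add: powr_realpow)
      then have r_le: "r \<le> c2 / real n"
        using p n by (simp add: r px c2_def divide_simps)
      have "p * (p powr x) = p powr (x + 1)" using p by (simp add: powr_add)
      also have "\<dots> \<le> p ^ s n"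
        using p s powr_mono'[of "real (s n)" "x + 1" p] by (simp add: powr_realpow)
      finally have "p * (1 / real n) * ((1 - p)\<^sup>2 / p\<^sup>2) \<le> r"
        unfolding r px by (intro mult_right_mono) simp_all
      then have r_ge: "c1 / real n \<le> r"
        using p by (simp add: c1_def power2_eq_square mult_ac)
      have "0 < c1 / real n" using c0 n by simp
      then have r0: "0 < r" using r_ge by linarith
      have r1: "r < 1" using r_le elim by linarith
      have choose: "x\<^sup>2 / 4 \<le> real (card ?W choose (s n - 2))"
      proof -
        have "card ?W choose (s n - 2) = s n choose 2"
          using sn binomial_symmetric[of 2 "s n"] by simp
        also have "real \<dots> = real (s n) * (real (s n) - 1) / 2"
          using sn by (simp add: choose_two of_nat_diff real_of_nat_div)
        finally have "real (card ?W choose (s n - 2)) = real (s n) * (real (s n) - 1) / 2" .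
        moreover have "x * (x / 2) \<le> real (s n) * (real (s n) - 1)"
          using s x4 by (intro mult_mono) auto
        ultimately show ?thesis by (simp add: power2_eq_square)
      qed
      have pow: "exp (- c2) / 2 \<le> (1 - r) ^ (card (?V - ?W) - 1)"
      proof -
        have "exp (- c2) / 2 \<le> (1 + (- c2) / real n) ^ n" using elim by simp
        also have "\<dots> \<le> (1 - r) ^ n" using r_le elim by (intro power_mono) auto
        also have "\<dots> \<le> (1 - r) ^ (card (?V - ?W) - 1)"
          using r0 r1 cardU by (intro power_decreasing) auto
        finally show ?thesis .
      qed
      \<comment> \<open>The 16 in \<open>c\<close> collects three losses: \<open>n / 2\<close>
        vertices, \<open>x\<^sup>2 / 4\<close> patterns and \<open>exp (- c2) / 2\<close> for
        uniqueness.\<close>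
      have "c * x\<^sup>2 = (real n / 2 * (x\<^sup>2 / 4)) * (c1 / real n * (exp (- c2) / 2))"
        using n by (simp add: c_def)
      also have "\<dots> \<le> (real (card (?V - ?W)) * real (card ?W choose (s n - 2))) * (r * (1 - r) ^ (card (?V - ?W) - 1))"
        using choose pow r_ge r0 c0 n sn cardU
        by (intro mult_mono mult_nonneg_nonneg) (auto simp: of_nat_diff)
      finally have \<mu>_ge: "c * x\<^sup>2 \<le> \<mu>" by (simp add: \<mu>_def)
      have cx: "0 < c * x\<^sup>2" using c0 x4 by simp
      have few: "pr (\<lambda>X. real (card (sifted (graph_of ?V X) ?W)) \<le> \<mu> / 2) \<le>
          4 / (c * x\<^sup>2) + 4 * (1 / (1 - c2 / real n)\<^sup>2 - 1)"
      proof -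
        have "pr (\<lambda>X. real (card (sifted (graph_of ?V X) ?W)) \<le> \<mu> / 2) \<le> 4 / \<mu> + 4 * (1 / (1 - r)\<^sup>2 - 1)"
          unfolding \<mu>_def r_def
          by (rule pr_few_sifted[OF W]) (use r1 cardU sn in \<open>auto simp: r_def\<close>)
        moreover have "4 / \<mu> \<le> 4 / (c * x\<^sup>2)"
          using \<mu>_ge cx by (intro divide_left_mono) auto
        moreover have "1 / (1 - r)\<^sup>2 \<le> 1 / (1 - c2 / real n)\<^sup>2"
        proof (intro divide_left_mono power_mono mult_pos_pos zero_less_power)
          show "1 - c2 / real n \<le> 1 - r" using r_le by simp
          show "0 < 1 - r" using r1 by simp
          show "0 < 1 - c2 / real n" "0 \<le> 1 - c2 / real n" using elim by linarith+
        qed simp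
        ultimately show ?thesis by argo
      qed
      \<comment> \<open>Rounding down keeps \<open>L\<close> below \<open>\<mu> / 2\<close>, so
        either few vertices are sifted or at least \<open>L\<close> are; it costs the 1 subtracted
        in \<open>f\<close>.\<close>
      define L where "L = nat \<lfloor>c * x\<^sup>2 / 2\<rfloor>"
      have L: "real L \<le> \<mu> / 2" "c * x\<^sup>2 / 2 - 1 \<le> real L"
        using cx \<mu>_ge unfolding L_def by linarith+
      have "\<rho> ^ L = exp (- \<gamma> * real L)"
        using \<rho> by (simp add: \<gamma>_def exp_of_nat2_mult)
      also have "\<dots> \<le> exp (- \<gamma> * (c * x\<^sup>2 / 2 - 1))"
        using L \<gamma> by simp
      finally have sift: "pr (\<lambda>X. \<not> weakly_sifting (graph_of ?V X) ?W \<and> L \<le> card (sifted (graph_of ?V X) ?W)) \<le>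
          (real n)\<^sup>2 * exp (- \<gamma> * (c * x\<^sup>2 / 2 - 1))"
        using pr_not_weakly_sifting[OF W, of L] unfolding \<rho>_def
        by (smt (verit) card_atLeastAtMost diff_Suc_1 mult_left_mono zero_le_power2)
      have "pr (\<lambda>X. \<not> weakly_sifting (graph_of ?V X) ?W) \<le> measure_pmf.prob edge_pmf
          ({X. real (card (sifted (graph_of ?V X) ?W)) \<le> \<mu> / 2} \<union>
           {X. \<not> weakly_sifting (graph_of ?V X) ?W \<and> L \<le> card (sifted (graph_of ?V X) ?W)})"
        using L by (intro measure_pmf.finite_measure_mono) auto
      also have "\<dots> \<le> pr (\<lambda>X. real (card (sifted (graph_of ?V X) ?W)) \<le> \<mu> / 2) +
          pr (\<lambda>X. \<not> weakly_sifting (graph_of ?V X) ?W \<and> L \<le> card (sifted (graph_of ?V X) ?W))"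
        by (rule measure_Un_le) auto
      also have "\<dots> \<le> f n" using few sift unfolding f_def x_def by linarith
      finally show ?case .
    qed
  qed
  ultimately show ?thesis by (rule that)
qed

text \<open>The term with \<open>4 / ln (1 / p)\<close> is chosen so that the exponent
  \<open>2 * (ln n)^2 / \<beta>\<close> of the failure probability exceeds that of the union bound,
  about \<open>(ln n)^2 / \<beta>\<close>. The case \<open>Suc n\<close> provides the comparison
  graph.\<close>

lemma pr_not_extension_property_tendsto_0:
  fixes p :: real
  assumes p: "0 < p" "p \<le> 1 / 2"
  defines "l \<equiv> \<lambda>n. nat \<lfloor>log (1 / p) (real n) - 2 * log (1 / p) (ln (real n)) - log (1 / p) (4 / ln (1 / p))\<rfloor>"
  obtains f :: "nat \<Rightarrow> real" where "f \<longlonglongrightarrow> 0"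
    "\<forall>\<^sub>F n in sequentially. \<forall>N\<in>{n, Suc n}. measure_pmf.prob (Pi_pmf (vpairs {1..N}) False (\<lambda>_. bernoulli_pmf p))
      {X. \<not> extension_property (l n) (graph_of {1..N} X)} \<le> f n"
proof -
  define \<beta> where "\<beta> = ln (1 / p)"
  have \<beta>: "0 < \<beta>" using p by (simp add: \<beta>_def)
  define f where "f n = exp ((ln (real n) * ln (2 * (real n + 1)) - 2 * (ln (real n))\<^sup>2) / \<beta>)" for n
  have "f \<longlonglongrightarrow> 0" unfolding f_def[abs_def] using \<beta> by real_asymp
  moreover have "\<forall>\<^sub>F n in sequentially. \<forall>N\<in>{n, Suc n}. measure_pmf.prob (Pi_pmf (vpairs {1..N}) False (\<lambda>_. bernoulli_pmf p))
      {X. \<not> extension_property (l n) (graph_of {1..N} X)} \<le> f n"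
  proof -
    define K where "K = ln (4 / \<beta>)"
    have ev1: "\<forall>\<^sub>F n in sequentially. 0 < ln (real n) / \<beta> - 2 * (ln (ln (real n)) / \<beta>) - K / \<beta>"
      using \<beta> by real_asymp
    have ev2: "\<forall>\<^sub>F n in sequentially. ln (real n) / \<beta> - 2 * (ln (ln (real n)) / \<beta>) - K / \<beta> < ln (real n) / \<beta>"
      using \<beta> by real_asymp
    have ev3: "\<forall>\<^sub>F n in sequentially. ln (real n) / \<beta> < real n / 2" using \<beta> by real_asymp
    have ev4: "\<forall>\<^sub>F n in sequentially. 3 \<le> n" by (rule eventually_ge_at_top)
    have ev5: "\<forall>\<^sub>F n in sequentially. 0 < ln (real n)" by real_asymp
    show ?thesis using ev1 ev2 ev3 ev4 ev5
    proof (eventually_elim, intro ballI)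
      fix n N assume n: "0 < ln (real n) / \<beta> - 2 * (ln (ln (real n)) / \<beta>) - K / \<beta>"
        "ln (real n) / \<beta> - 2 * (ln (ln (real n)) / \<beta>) - K / \<beta> < ln (real n) / \<beta>"
        "ln (real n) / \<beta> < real n / 2" "3 \<le> n" "0 < ln (real n)" and N: "N \<in> {n, Suc n}"
      interpret edge_space "{1..N}" p using p by unfold_locales auto
      define y where "y = log (1 / p) (real n) - 2 * log (1 / p) (ln (real n)) - log (1 / p) (4 / ln (1 / p))"
      have y: "0 < y" "y < ln (real n) / \<beta>" using n by (simp_all add: y_def K_def log_def \<beta>_def)
      have ln: "real (l n) \<le> y" using y unfolding l_def y_def[symmetric] by linarith
      have lN: "2 * l n \<le> n" using ln y n by linarith
      have "4 / \<beta> * (ln (real n))\<^sup>2 / real n =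
          p powr (log (1 / p) (real n)) / (p powr (log (1 / p) (ln (real n))))\<^sup>2 / p powr (log (1 / p) (4 / ln (1 / p)))"
        using p n \<beta> by (simp add: powr_log_inverse_base \<beta>_def power2_eq_square mult_ac)
      also have "\<dots> = p powr y"
        by (simp only: y_def powr_diff power2_eq_square mult_2 powr_add)
      also have "\<dots> \<le> p powr real (l n)" using p ln by (intro powr_mono') auto
      finally have pl: "4 / \<beta> * (ln (real n))\<^sup>2 / real n \<le> p ^ l n" using p by (simp add: powr_realpow)
      \<comment> \<open>At least \<open>n / 2\<close> vertices remain outside a set of size
        \<open>l n\<close>, which turns the 4 into a 2.\<close>
      have "2 / \<beta> * (ln (real n))\<^sup>2 = 4 / \<beta> * (ln (real n))\<^sup>2 / real n * (real n / 2)"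
        using n by simp
      also have "\<dots> \<le> p ^ l n * real (N - l n)"
        using pl N lN p \<beta> by (intro mult_mono) auto
      finally have e: "2 / \<beta> * (ln (real n))\<^sup>2 \<le> p ^ l n * real (N - l n)" .
      have "(2 * real N) ^ l n \<le> (2 * (real n + 1)) ^ l n"
        using N by (intro power_mono) auto
      also have "\<dots> = exp (real (l n) * ln (2 * (real n + 1)))" by (simp add: exp_of_nat_mult)
      also have "\<dots> \<le> exp (ln (real n) / \<beta> * ln (2 * (real n + 1)))"
        using ln y n by (intro iffD2[OF exp_le_cancel_iff] mult_right_mono) auto
      finally have pw: "(2 * real N) ^ l n \<le> exp (ln (real n) / \<beta> * ln (2 * (real n + 1)))" .
      have "pr (\<lambda>X. \<not> extension_property (l n) (graph_of {1..N} X)) \<le>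
          (2 * real N) ^ l n * exp (- (p ^ l n * real (N - l n)))"
        using pr_not_extension_property[of "l n"] p lN N by auto
      also have "\<dots> \<le> exp (ln (real n) / \<beta> * ln (2 * (real n + 1))) * exp (- (2 / \<beta> * (ln (real n))\<^sup>2))"
        using pw e by (intro mult_mono) auto
      also have "\<dots> = f n" by (simp add: f_def diff_divide_distrib flip: exp_add)
      finally show "pr (\<lambda>X. \<not> extension_property (l n) (graph_of {1..N} X)) \<le> f n" .
    qed
  qed
  ultimately show ?thesis by (rule that)
qed

section \<open>Entropy comparison and the bounds with high probability\<close>

lemma random_graph_conv_graph_of:
  "random_graph n p = map_pmf (graph_of {1..n}) (Pi_pmf (vpairs {1..n}) False (\<lambda>_. bernoulli_pmf p))"
  unfolding random_graph_def graph_of_def ..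

text \<open>Since \<open>p \<le> q\<close>, replacing \<open>- ln q\<close> by \<open>- ln p\<close>
  only increases the entropy, and the weights add up to 1.\<close>

lemma entropy_le:
  fixes p q :: real
  assumes "0 < p" "p \<le> 1 / 2" "q = 1 - p"
  shows "0 < - p * ln p - q * ln q" "- p * ln p - q * ln q \<le> ln (1 / p)"
proof -
  have q: "0 < q" "q < 1" "p \<le> q" using assms by auto
  have "0 < - p * ln p" using assms by (simp add: mult_pos_neg)
  moreover have "0 < - q * ln q" using q by (simp add: mult_pos_neg)
  ultimately show "0 < - p * ln p - q * ln q" by linarith
  have "q * ln p \<le> q * ln q" using assms q by (intro mult_left_mono) auto
  then have "- p * ln p - q * ln q \<le> - (p + q) * ln p" by (simp add: algebra_simps)
  then show "- p * ln p - q * ln q \<le> ln (1 / p)" using assms by (simp add: ln_div)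
qed

theorem theorem3p1:
  fixes p q :: real
  assumes "0 < p" and "p \<le> 1 / 2" and "q = 1 - p"
  shows "\<exists>(C :: real) (\<epsilon> :: nat \<Rightarrow> real). \<epsilon> \<longlonglongrightarrow> 0 \<and>
    (\<lambda>n. measure_pmf.prob (random_graph n p)
       {G. - C \<le> real (logical_depth G) - log (1 / p) (real n) + 2 * log (1 / p) (ln (real n)) \<and>
           real (logical_depth G) - log (1 / p) (real n) + 2 * log (1 / p) (ln (real n))
             \<le> (2 + \<epsilon> n) * (ln (ln (real n)) / (- p * ln p - q * ln q))})
      \<longlonglongrightarrow> 1"
proof -
  define h where "h = - p * ln p - q * ln q"
  have h: "0 < h" "h \<le> ln (1 / p)" using entropy_le[OF assms] by (simp_all add: h_def)
  define lg where "lg = log (1 / p)"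
  define C where "C = lg (4 / ln (1 / p))"
  \<comment> \<open>Chosen so that \<open>\<epsilon> n * (ln (ln n) / h) = 4\<close>, which covers
    \<open>s n + 3 \<le> lg n + 4\<close>.\<close>
  define \<epsilon> where "\<epsilon> n = 4 * h / ln (ln (real n))" for n :: nat
  define l where "l n = nat \<lfloor>lg (real n) - 2 * lg (ln (real n)) - C\<rfloor>" for n :: nat
  define s where "s n = nat \<lceil>lg (real n)\<rceil>" for n :: nat
  define P where "P N = Pi_pmf (vpairs {1..N}) False (\<lambda>_. bernoulli_pmf p)" for N :: nat
  define good where "good n = {G. - C \<le> real (logical_depth G) - lg (real n) + 2 * lg (ln (real n)) \<and>
    real (logical_depth G) - lg (real n) + 2 * lg (ln (real n)) \<le> (2 + \<epsilon> n) * (ln (ln (real n)) / h)}" for n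
  obtain f where f: "f \<longlonglongrightarrow> 0" "\<forall>\<^sub>F n in sequentially. \<forall>N\<in>{n, Suc n}.
      measure_pmf.prob (P N) {X. \<not> extension_property (l n) (graph_of {1..N} X)} \<le> f n"
    using pr_not_extension_property_tendsto_0[OF assms(1,2)]
    unfolding l_def[abs_def] lg_def C_def P_def[abs_def] by blast
  obtain g where g: "g \<longlonglongrightarrow> 0" "\<forall>\<^sub>F n in sequentially.
      measure_pmf.prob (P n) {X. \<not> weakly_sifting (graph_of {1..n} X) {1..s n}} \<le> g n"
    using pr_not_weakly_sifting_tendsto_0[OF assms(1,2)]
    unfolding s_def[abs_def] lg_def P_def[abs_def] by blast
  have \<epsilon>: "\<epsilon> \<longlonglongrightarrow> 0" unfolding \<epsilon>_def[abs_def] by real_asymp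
  have "\<forall>\<^sub>F n in sequentially. f n < 1" using order_tendstoD(2)[OF f(1)] by simp
  moreover have "\<forall>\<^sub>F n in sequentially. ln (real n) / ln (1 / p) + 1 < real n"
    using assms by real_asymp
  moreover have "\<forall>\<^sub>F n in sequentially. 0 < ln (ln (real n))" by real_asymp
  moreover have "\<forall>\<^sub>F n in sequentially. 1 \<le> n" by (rule eventually_ge_at_top)
  ultimately have lower: "\<forall>\<^sub>F n in sequentially. 1 - f n - g n \<le> measure_pmf.prob (random_graph n p) (good n)"
    using f(2) g(2)
  proof eventually_elim
    case (elim n)
    \<comment> \<open>A failure probability below 1 yields one fixed graph on \<open>n + 1\<close>
      vertices with the extension property; it is compared with every good graph on \<open>n\<close>
      vertices.\<close>
    have "measure_pmf.prob (P (Suc n)) {X. \<not> extension_property (l n) (graph_of {1..Suc n} X)} < 1"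
      using elim by (meson insertCI le_less_trans)
    then obtain Y where Y: "extension_property (l n) (graph_of {1..Suc n} Y)"
      using prob_Not[of "P (Suc n)" "\<lambda>X. extension_property (l n) (graph_of {1..Suc n} X)"] by force
    have p1: "0 \<le> ln (1 / p)" using assms by simp
    have "0 \<le> lg (real n)" "lg (real n) + 1 < real n"
      using elim p1 by (simp_all add: lg_def log_def)
    then have s: "real (s n) \<le> lg (real n) + 1" "s n \<le> n" unfolding s_def by linarith+
    have "graph_of {1..n} X \<in> good n"
      if X: "extension_property (l n) (graph_of {1..n} X)" "weakly_sifting (graph_of {1..n} X) {1..s n}" for X
    proof -
      let ?G = "graph_of {1..n} X"
      have "\<not> graph_iso ?G (graph_of {1..Suc n} Y)"
        using graph_iso_card[of ?G "graph_of {1..Suc n} Y"] by auto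
      then have D: "l n < logical_depth ?G" "logical_depth ?G \<le> s n + 3"
        using logical_depth_bounds[OF simple_graph_graph_of simple_graph_graph_of X(1) Y _ _ X(2)] s elim by auto
      have "lg (real n) - 2 * lg (ln (real n)) - C \<le> real (logical_depth ?G)"
        using D(1) unfolding l_def by linarith
      moreover have "2 * lg (ln (real n)) + 4 \<le> (2 + \<epsilon> n) * (ln (ln (real n)) / h)"
      proof -
        \<comment> \<open>The entropy \<open>h\<close> is at most \<open>ln (1 / p)\<close>, so
          dividing the positive number \<open>ln (ln n)\<close> by \<open>h\<close> gives the larger
          quotient.\<close>
        have "lg (ln (real n)) \<le> ln (ln (real n)) / h"
          using elim h unfolding lg_def log_def by (intro divide_left_mono mult_pos_pos) auto
        moreover have "\<epsilon> n * (ln (ln (real n)) / h) = 4"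
          using elim h by (simp add: \<epsilon>_def)
        ultimately show ?thesis unfolding distrib_right by linarith
      qed
      ultimately show ?thesis unfolding good_def using D(2) s by auto
    qed
    then have "- graph_of {1..n} -` good n \<subseteq>
        {X. \<not> extension_property (l n) (graph_of {1..n} X)} \<union> {X. \<not> weakly_sifting (graph_of {1..n} X) {1..s n}}"
      by blast
    then have "measure_pmf.prob (P n) (- graph_of {1..n} -` good n) \<le>
        measure_pmf.prob (P n) ({X. \<not> extension_property (l n) (graph_of {1..n} X)} \<union>
          {X. \<not> weakly_sifting (graph_of {1..n} X) {1..s n}})"
      by (intro measure_pmf.finite_measure_mono) auto
    also have "\<dots> \<le> measure_pmf.prob (P n) {X. \<not> extension_property (l n) (graph_of {1..n} X)} +
        measure_pmf.prob (P n) {X. \<not> weakly_sifting (graph_of {1..n} X) {1..s n}}"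
      by (rule measure_Un_le) auto
    also have "\<dots> \<le> f n + g n" using elim by (intro add_mono) auto
    finally have "measure_pmf.prob (P n) (- graph_of {1..n} -` good n) \<le> f n + g n" .
    moreover have "measure_pmf.prob (random_graph n p) (good n) =
        1 - measure_pmf.prob (P n) (- graph_of {1..n} -` good n)"
      using measure_pmf.prob_compl[of "graph_of {1..n} -` good n" "P n"]
      by (simp add: random_graph_conv_graph_of P_def Compl_eq_Diff_UNIV)
    ultimately show ?case by linarith
  qed
  have "(\<lambda>n. 1 - f n - g n) \<longlonglongrightarrow> 1 - 0 - 0" by (intro tendsto_intros f(1) g(1))
  then have "(\<lambda>n. 1 - f n - g n) \<longlonglongrightarrow> 1" by simp
  then have "(\<lambda>n. measure_pmf.prob (random_graph n p) (good n)) \<longlonglongrightarrow> 1"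
    using tendsto_sandwich[OF lower always_eventually _ tendsto_const[of 1]] by simp
  then show ?thesis
    using \<epsilon> unfolding good_def lg_def h_def by (intro exI[of _ C] exI[of _ \<epsilon>] conjI)
qed

end
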